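(* Consider the quadrature-based discontinuous Galerkin method given in the context on a periodic domain (no boundary mortar elements), and assume the following constraints. (1) (Approximation consistency) The volume and mortar approximation spaces contain the constants; $\mathbf 1^e$ denotes the degrees of freedom of the constant $1$ on $e$ and $\mathbf 1^m$ the constant $1$ on $m$ at the mortar quadrature nodes. (2) (Projection consistency) For each $m\in\mathbb M$, $\sum_{e\in\mathbb E^{-m}}\mathbf P^{m,e}\mathbf 1^e=\sum_{e\in\mathbb E^{+m}}\mathbf P^{m,e}\mathbf 1^e=\mathbf 1^m$. (3) (Stiffness consistency) $\mathbf S_j^e\mathbf 1^e=\mathbf 0$ for all $e$ and $j$. (4) (Consistent numerical flux) If $v_i^{+m}=v_i^{-m}$ and $T_i^{+m}=T_i^{-m}$ for $i=1,2,3$, then $v_i^{*m}=v_i^{\pm m}$ and $T_i^{*m}=T_i^{\pm m}$. (5) (Discrete divergence theorem) For all $e$ and $j$, $(\mathbf S_j^e)^T\mathbf 1^e=\sum_{m\in\mathbb M^e}(\mathbf P^{m,e})^T\mathbf W^m\mathbf n_j^{m[e]}$. (6) (Consistent constant traction calculation) If for some symmetric constants $\sigma_{ij}\in\mathbb R$ one has $\boldsymbol\sigma_{ij}^e=\sigma_{ij}\mathbf 1^e$ for all $e\in\mathbb E^m$, then $\mathbf T_i^{-m}=\mathbf T_i^{+m}=\sigma_{ij}\mathbf n_j^m$. Then the method is constant preserving: if $\mathbf v_i^e=\beta_i\mathbf 1^e$ and $\boldsymbol\sigma_{ij}^e=\alpha_{ij}\mathbf 1^e$ for all $e\in\mathbb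 E$, with constants $\beta_i$ and $\alpha_{ij}=\alpha_{ji}$, then for every $e\in\mathbb E$ and all $i,j$ $$\mathbf M_\rho^e\frac{d\mathbf v_i^e}{dt}=\mathbf 0,\qquad \mathbf M^e_{S_{ijkl}}\frac{d\boldsymbol\sigma_{kl}^e}{dt}=\mathbf 0,$$ so that the solution remains constant in time.
   Context: Conventions: $d\in\{2,3\}$; repeated subscripts $i,j,k,l$ are summed over $1,2,3$; for $d=2$ all objects representing $x_3$-derivatives and normal components $n_3$ are zero. Mesh: $\mathbb E$ is a finite set of volume elements and $\mathbb M$ a finite set of mortar elements partitioning the union of the element boundaries. $\mathbb M^e$ is the set of mortar elements meeting $\partial e$ and $\mathbb E^m=\{e:m\in\mathbb M^e\}$. Each $m$ has a chosen unit normal, and $\mathbb E^m=\mathbb E^{+m}\cup\mathbb E^{-m}$ (disjoint), where $\mathbb E^{+m}$ are the elements on the side toward which the normal points and $\mathbb E^{-m}$ those on the other side. Each element $e$ (mortar $m$) has a reference element $\hat e$ ($\hat m$). Discrete operators: functions in the finite-dimensional space $\hat V^e$ on $\hat e$ are represented by vectors of degrees of freedom (bold, superscript $e$). $\mathbf M_\rho^e$ is the $\rho$-weighted mass matrix, symmetric positive definite. For each $i,j,k,l$, $\mathbf M^e_{S_{ijkl}}$ is the (symmetric) mass matrix weighted by the compliance tensor component $S_{ijkl}$ (possibly variable), so $\mathbf M^e_{S_{ijkl}}=\mathbf M^e_{S_{klij}}=\mathbf M^e_{S_{jikl}}=\mathbf M^e_{S_{ijlk}}$; it is assumed that $(\mathbf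 s_{ij})^T\mathbf M^e_{S_{ijkl}}\mathbf s_{kl}>0$ for every collection of vectors $\mathbf s_{ij}=\mathbf s_{ji}$ not all zero. $\mathbf S_j^e$ is a square stiffness matrix, with $(\mathbf p^e)^T\mathbf S_j^e\mathbf q^e$ approximating $\int_{\hat e}J^ep^e\,\partial q^e/\partial x_j$. On $m$ there is a quadrature rule on $\hat m$ with positive weights $\omega_n^m$; $\mathbf W^m$ is the diagonal matrix with entries $\omega_n^mS_J^m$ evaluated at the $n$-th node, where $S_J^m>0$ is the surface Jacobian determinant. $\mathbf n_j^m$ is the vector of values at the mortar quadrature nodes of the $j$-th component of the unit normal of $m$; $\mathbf n_j^{m[e]}=\mathbf n_j^m$ if $e\in\mathbb E^{-m}$ and $-\mathbf n_j^m$ if $e\in\mathbb E^{+m}$. For $e\in\mathbb E^m$, $\mathbf P^{m,e}$ is a matrix taking degrees of freedom on $e$ to values at the mortar quadrature nodes. $\mathbf P^{m,e}_{n_j}$ is a matrix such that $\mathbf P^{m,e}_{n_j}\boldsymbol\sigma_{ij}^e$ (summed over $j$) is the approximate mortar traction at the quadrature nodes, obtained by multiplying by the unit normal (outward to $e$) before or after projection; one choice is fixed. Mortar states (vectors of values at the mortar quadrature nodes): $\mathbf v_i^{m,e}=\mathbf P^{m,e}\mathbf v_i^e$, $\mathbf T_i^{m,e}=\mathbf P^{m,e}_{n_j}\boldsymbol\sigma^e_{ij}$, $\mathbf v_i^{\pm m}=\sum_{e\in\mathbb E^{\pm m}}\mathbf v_i^{m,e}$, $\mathbf T_i^{\pm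 m}=\mp\sum_{e\in\mathbb E^{\pm m}}\mathbf T_i^{m,e}$; $\mathbf v_i^{m[e]}=\mathbf v_i^{\pm m}$ if $e\in\mathbb E^{\pm m}$. A numerical flux assigns pointwise at each mortar quadrature node values $(T_i^{*m},v_i^{*m})$ as a function of the states $v_i^{\pm m},T_i^{\pm m}$ there, giving $\mathbf T_i^{*m},\mathbf v_i^{*m}$. $\mathbf T_i^{*m[e]}=\mathbf T_i^{*m}$ if $e\in\mathbb E^{-m}$ and $-\mathbf T_i^{*m}$ if $e\in\mathbb E^{+m}$. Method: for each $e\in\mathbb E$ find (differentiable in $t$) $\mathbf v_i^e$ and symmetric $\boldsymbol\sigma_{ij}^e=\boldsymbol\sigma_{ji}^e$ such that $$\mathbf M_\rho^e\frac{d\mathbf v_i^e}{dt}=-(\mathbf S_j^e)^T\boldsymbol\sigma_{ij}^e+\sum_{m\in\mathbb M^e}(\mathbf P^{m,e})^T\mathbf W^m\mathbf T_i^{*m[e]},$$ and, for all symmetric collections of vectors $\boldsymbol\psi_{ij}=\boldsymbol\psi_{ji}$, $$(\boldsymbol\psi_{ij})^T\mathbf M^e_{S_{ijkl}}\frac{d\boldsymbol\sigma_{kl}^e}{dt}=(\boldsymbol\psi_{ij})^T\left[\frac12\left(\mathbf S_j^e\mathbf v_i^e+\mathbf S_i^e\mathbf v_j^e\right)+\sum_{m\in\mathbb M^e}(\mathbf P^{m,e}_{n_j})^T\mathbf W^m(\mathbf v_i^{*m}-\mathbf v_i^{m[e]})\right].$$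
   Formalization: That every solution starting from a constant state remains constant is proved for locally Lipschitz numerical fluxes (it fails for some merely consistent fluxes); for any consistent flux the displayed equations hold and the constant state is shown to be a solution. *)

theory Defs
  imports "HOL-Analysis.Analysis" "Jordan_Normal_Form.Matrix"
begin

unbundle no vec_syntax and no inner_syntax

text \<open>
  Vectors of degrees of freedom and vectors of nodal values have a length that depends on the
  element or mortar, so they are vectors and matrices of \<^theory>\<open>Jordan_Normal_Form.Matrix\<close>.
  The indices \<open>i, j, k, l\<close> have the three-element type \<open>3\<close>, so a repeated index is a sum over
  \<open>UNIV :: 3 set\<close>.
\<close>

abbreviation vsum :: "nat \<Rightarrow> ('a \<Rightarrow> real vec) \<Rightarrow> 'a set \<Rightarrow> real vec" where
  "vsum n f A \<equiv> finsum_vec TYPE(real) n f A"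

text \<open>
  \<open>'x\<close> is the space of the volume reference elements (dimension \<open>d\<close>), \<open>'y\<close> that of the mortar
  reference elements (dimension \<open>d - 1\<close>).  The mesh enters only through incidence: which mortars
  lie on the boundary of an element, and on which side of a mortar an element lies.
  The argument of \<open>flux m n\<close>, the numerical flux at node \<open>n\<close> of \<open>m\<close>, is the
  tuple (v+, v-, T+, T-) and its value is (T*, v*).
  \<open>projection_n m e j\<close> is the matrix that multiplies by the \<open>j\<close>-th component of the normal outward
  to \<open>e\<close> and projects, in either order; it is not tied to \<open>projection m e\<close> here.
\<close>

record ('e, 'm, 'x, 'y) dg_scheme =
  elements :: "'e set"
  mortars :: "'m set"
  mortars_of :: "'e \<Rightarrow> 'm set"
  plus_side :: "'m \<Rightarrow> 'e set"
  minus_side :: "'m \<Rightarrow> 'e set"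
  ref_element :: "'e \<Rightarrow> 'x set"
  ref_mortar :: "'m \<Rightarrow> 'y set"
  ndof :: "'e \<Rightarrow> nat"
  basis_fun :: "'e \<Rightarrow> nat \<Rightarrow> 'x \<Rightarrow> real"
  mortar_ndof :: "'m \<Rightarrow> nat"
  mortar_basis_fun :: "'m \<Rightarrow> nat \<Rightarrow> 'y \<Rightarrow> real"
  nquad :: "'m \<Rightarrow> nat"
  qnode :: "'m \<Rightarrow> nat \<Rightarrow> 'y"
  qweight :: "'m \<Rightarrow> nat \<Rightarrow> real"
  surf_jac :: "'m \<Rightarrow> 'y \<Rightarrow> real"
  unit_normal :: "'m \<Rightarrow> 'y \<Rightarrow> real^3"
  mass_rho :: "'e \<Rightarrow> real mat"
  mass_S :: "'e \<Rightarrow> 3 \<Rightarrow> 3 \<Rightarrow> 3 \<Rightarrow> 3 \<Rightarrow> real mat"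
  stiff :: "'e \<Rightarrow> 3 \<Rightarrow> real mat"
  projection :: "'m \<Rightarrow> 'e \<Rightarrow> real mat"
  projection_n :: "'m \<Rightarrow> 'e \<Rightarrow> 3 \<Rightarrow> real mat"
  flux :: "'m \<Rightarrow> nat \<Rightarrow> (real^3) \<times> (real^3) \<times> (real^3) \<times> (real^3) \<Rightarrow> (real^3) \<times> (real^3)"

definition elements_of :: "('e, 'm, 'x, 'y) dg_scheme \<Rightarrow> 'm \<Rightarrow> 'e set" where
  "elements_of G m = {e \<in> elements G. m \<in> mortars_of G e}"


subsection \<open>Approximation spaces\<close>

definition represents :: "nat \<Rightarrow> (nat \<Rightarrow> 'a \<Rightarrow> real) \<Rightarrow> 'a set \<Rightarrow> real vec \<Rightarrow> ('a \<Rightarrow> real) \<Rightarrow> bool" where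
  "represents N \<phi> \<Omega> c f \<longleftrightarrow>
     c \<in> carrier_vec N \<and> (\<forall>x\<in>\<Omega>. f x = (\<Sum>a<N. c $ a * \<phi> a x))"

definition is_basis_on :: "nat \<Rightarrow> (nat \<Rightarrow> 'a \<Rightarrow> real) \<Rightarrow> 'a set \<Rightarrow> bool" where
  "is_basis_on N \<phi> \<Omega> \<longleftrightarrow> (\<forall>c. represents N \<phi> \<Omega> c (\<lambda>_. 0) \<longrightarrow> c = 0\<^sub>v N)"

definition one_elem :: "('e, 'm, 'x, 'y) dg_scheme \<Rightarrow> 'e \<Rightarrow> real vec" where
  "one_elem G e = (THE c. represents (ndof G e) (basis_fun G e) (ref_element G e) c (\<lambda>_. 1))"

definition one_mortar :: "('e, 'm, 'x, 'y) dg_scheme \<Rightarrow> 'm \<Rightarrow> real vec" where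
  "one_mortar G m = Matrix.vec (nquad G m) (\<lambda>_. 1)"


subsection \<open>Standing assumptions on the discretization\<close>

definition mesh_ok :: "('e, 'm, 'x, 'y) dg_scheme \<Rightarrow> bool" where
  "mesh_ok G \<longleftrightarrow>
     finite (elements G) \<and> finite (mortars G) \<and>
     (\<forall>e\<in>elements G. mortars_of G e \<subseteq> mortars G) \<and>
     (\<forall>m\<in>mortars G. elements_of G m = plus_side G m \<union> minus_side G m \<and>
        plus_side G m \<inter> minus_side G m = {})"

definition spaces_ok :: "('e, 'm, 'x, 'y) dg_scheme \<Rightarrow> bool" where
  "spaces_ok G \<longleftrightarrow>
     (\<forall>e\<in>elements G. is_basis_on (ndof G e) (basis_fun G e) (ref_element G e)) \<and>
     (\<forall>m\<in>mortars G. is_basis_on (mortar_ndof G m) (mortar_basis_fun G m) (ref_mortar G m))"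

definition quadrature_ok :: "('e, 'm, 'x, 'y) dg_scheme \<Rightarrow> bool" where
  "quadrature_ok G \<longleftrightarrow>
     (\<forall>m\<in>mortars G.
        (\<forall>n<nquad G m. qnode G m n \<in> ref_mortar G m \<and> qweight G m n > 0) \<and>
        (\<forall>y\<in>ref_mortar G m. surf_jac G m y > 0 \<and> norm (unit_normal G m y) = 1))"

definition mass_rho_ok :: "('e, 'm, 'x, 'y) dg_scheme \<Rightarrow> bool" where
  "mass_rho_ok G \<longleftrightarrow>
     (\<forall>e\<in>elements G.
        mass_rho G e \<in> carrier_mat (ndof G e) (ndof G e) \<and>
        transpose_mat (mass_rho G e) = mass_rho G e \<and>
        (\<forall>p\<in>carrier_vec (ndof G e). p \<noteq> 0\<^sub>v (ndof G e) \<longrightarrow> p \<bullet> (mass_rho G e *\<^sub>v p) > 0))"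

definition sym_coll :: "nat \<Rightarrow> (3 \<Rightarrow> 3 \<Rightarrow> real vec) \<Rightarrow> bool" where
  "sym_coll N s \<longleftrightarrow> (\<forall>i j. s i j \<in> carrier_vec N \<and> s i j = s j i)"

definition mass_S_ok :: "('e, 'm, 'x, 'y) dg_scheme \<Rightarrow> bool" where
  "mass_S_ok G \<longleftrightarrow>
     (\<forall>e\<in>elements G.
        (\<forall>i j k l.
           mass_S G e i j k l \<in> carrier_mat (ndof G e) (ndof G e) \<and>
           transpose_mat (mass_S G e i j k l) = mass_S G e i j k l \<and>
           mass_S G e i j k l = mass_S G e k l i j \<and>
           mass_S G e i j k l = mass_S G e j i k l \<and>
           mass_S G e i j k l = mass_S G e i j l k) \<and>
        (\<forall>s. sym_coll (ndof G e) s \<and> (\<exists>i j. s i j \<noteq> 0\<^sub>v (ndof G e)) \<longrightarrow>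
           (\<Sum>i\<in>UNIV. \<Sum>j\<in>UNIV. \<Sum>k\<in>UNIV. \<Sum>l\<in>UNIV.
              s i j \<bullet> (mass_S G e i j k l *\<^sub>v s k l)) > 0))"

definition operators_ok :: "('e, 'm, 'x, 'y) dg_scheme \<Rightarrow> bool" where
  "operators_ok G \<longleftrightarrow>
     (\<forall>e\<in>elements G. \<forall>j. stiff G e j \<in> carrier_mat (ndof G e) (ndof G e)) \<and>
     (\<forall>m\<in>mortars G. \<forall>e\<in>elements_of G m.
        projection G m e \<in> carrier_mat (nquad G m) (ndof G e) \<and>
        (\<forall>j. projection_n G m e j \<in> carrier_mat (nquad G m) (ndof G e)))"

definition dimension_ok :: "('e, 'm, 'x::euclidean_space, 'y::euclidean_space) dg_scheme \<Rightarrow> bool" where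
  "dimension_ok G \<longleftrightarrow>
     DIM('x) \<in> {2, 3} \<and> DIM('y) = DIM('x) - 1 \<and>
     (DIM('x) = 2 \<longrightarrow>
        (\<forall>e\<in>elements G. stiff G e 3 = 0\<^sub>m (ndof G e) (ndof G e)) \<and>
        (\<forall>m\<in>mortars G. \<forall>y\<in>ref_mortar G m. vec_nth (unit_normal G m y) 3 = 0) \<and>
        (\<forall>m\<in>mortars G. \<forall>e\<in>elements_of G m.
           projection_n G m e 3 = 0\<^sub>m (nquad G m) (ndof G e)))"

definition dg_ok :: "('e, 'm, 'x::euclidean_space, 'y::euclidean_space) dg_scheme \<Rightarrow> bool" where
  "dg_ok G \<longleftrightarrow> dimension_ok G \<and> mesh_ok G \<and> spaces_ok G \<and> quadrature_ok G \<and>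
     mass_rho_ok G \<and> mass_S_ok G \<and> operators_ok G"

definition no_boundary_mortars :: "('e, 'm, 'x, 'y) dg_scheme \<Rightarrow> bool" where
  "no_boundary_mortars G \<longleftrightarrow>
     (\<forall>m\<in>mortars G. plus_side G m \<noteq> {} \<and> minus_side G m \<noteq> {})"


subsection \<open>Mortar states and numerical flux\<close>

definition W :: "('e, 'm, 'x, 'y) dg_scheme \<Rightarrow> 'm \<Rightarrow> real mat" where
  "W G m = mat_diag (nquad G m) (\<lambda>n. qweight G m n * surf_jac G m (qnode G m n))"

definition normal :: "('e, 'm, 'x, 'y) dg_scheme \<Rightarrow> 'm \<Rightarrow> 3 \<Rightarrow> real vec" where
  "normal G m j = Matrix.vec (nquad G m) (\<lambda>n. vec_nth (unit_normal G m (qnode G m n)) j)"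

definition normal_e :: "('e, 'm, 'x, 'y) dg_scheme \<Rightarrow> 'm \<Rightarrow> 'e \<Rightarrow> 3 \<Rightarrow> real vec" where
  "normal_e G m e j = (if e \<in> minus_side G m then normal G m j else - normal G m j)"

type_synonym 'e velocity = "'e \<Rightarrow> 3 \<Rightarrow> real vec"
type_synonym 'e stress = "'e \<Rightarrow> 3 \<Rightarrow> 3 \<Rightarrow> real vec"

definition v_mortar :: "('e, 'm, 'x, 'y) dg_scheme \<Rightarrow> 'e velocity \<Rightarrow> 'm \<Rightarrow> 'e \<Rightarrow> 3 \<Rightarrow> real vec" where
  "v_mortar G v m e i = projection G m e *\<^sub>v v e i"

definition T_mortar :: "('e, 'm, 'x, 'y) dg_scheme \<Rightarrow> 'e stress \<Rightarrow> 'm \<Rightarrow> 'e \<Rightarrow> 3 \<Rightarrow> real vec" where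
  "T_mortar G \<sigma> m e i = vsum (nquad G m) (\<lambda>j. projection_n G m e j *\<^sub>v \<sigma> e i j) UNIV"

definition v_plus :: "('e, 'm, 'x, 'y) dg_scheme \<Rightarrow> 'e velocity \<Rightarrow> 'm \<Rightarrow> 3 \<Rightarrow> real vec" where
  "v_plus G v m i = vsum (nquad G m) (\<lambda>e. v_mortar G v m e i) (plus_side G m)"

definition v_minus :: "('e, 'm, 'x, 'y) dg_scheme \<Rightarrow> 'e velocity \<Rightarrow> 'm \<Rightarrow> 3 \<Rightarrow> real vec" where
  "v_minus G v m i = vsum (nquad G m) (\<lambda>e. v_mortar G v m e i) (minus_side G m)"

definition T_plus :: "('e, 'm, 'x, 'y) dg_scheme \<Rightarrow> 'e stress \<Rightarrow> 'm \<Rightarrow> 3 \<Rightarrow> real vec" where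
  "T_plus G \<sigma> m i = - vsum (nquad G m) (\<lambda>e. T_mortar G \<sigma> m e i) (plus_side G m)"

definition T_minus :: "('e, 'm, 'x, 'y) dg_scheme \<Rightarrow> 'e stress \<Rightarrow> 'm \<Rightarrow> 3 \<Rightarrow> real vec" where
  "T_minus G \<sigma> m i = vsum (nquad G m) (\<lambda>e. T_mortar G \<sigma> m e i) (minus_side G m)"

definition v_side :: "('e, 'm, 'x, 'y) dg_scheme \<Rightarrow> 'e velocity \<Rightarrow> 'm \<Rightarrow> 'e \<Rightarrow> 3 \<Rightarrow> real vec" where
  "v_side G v m e i = (if e \<in> minus_side G m then v_minus G v m i else v_plus G v m i)"

definition flux_at ::
  "('e, 'm, 'x, 'y) dg_scheme \<Rightarrow> 'e velocity \<Rightarrow> 'e stress \<Rightarrow> 'm \<Rightarrow> nat \<Rightarrow> (real^3) \<times> (real^3)" where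
  "flux_at G v \<sigma> m n = flux G m n
     (vec_lambda (\<lambda>i. v_plus G v m i $ n), vec_lambda (\<lambda>i. v_minus G v m i $ n),
      vec_lambda (\<lambda>i. T_plus G \<sigma> m i $ n), vec_lambda (\<lambda>i. T_minus G \<sigma> m i $ n))"

definition T_star ::
  "('e, 'm, 'x, 'y) dg_scheme \<Rightarrow> 'e velocity \<Rightarrow> 'e stress \<Rightarrow> 'm \<Rightarrow> 3 \<Rightarrow> real vec" where
  "T_star G v \<sigma> m i = Matrix.vec (nquad G m) (\<lambda>n. vec_nth (fst (flux_at G v \<sigma> m n)) i)"

definition v_star ::
  "('e, 'm, 'x, 'y) dg_scheme \<Rightarrow> 'e velocity \<Rightarrow> 'e stress \<Rightarrow> 'm \<Rightarrow> 3 \<Rightarrow> real vec" where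
  "v_star G v \<sigma> m i = Matrix.vec (nquad G m) (\<lambda>n. vec_nth (snd (flux_at G v \<sigma> m n)) i)"

definition T_star_e ::
  "('e, 'm, 'x, 'y) dg_scheme \<Rightarrow> 'e velocity \<Rightarrow> 'e stress \<Rightarrow> 'm \<Rightarrow> 'e \<Rightarrow> 3 \<Rightarrow> real vec" where
  "T_star_e G v \<sigma> m e i = (if e \<in> minus_side G m then T_star G v \<sigma> m i else - T_star G v \<sigma> m i)"


subsection \<open>The semidiscrete method\<close>

definition velocity_rhs ::
  "('e, 'm, 'x, 'y) dg_scheme \<Rightarrow> 'e velocity \<Rightarrow> 'e stress \<Rightarrow> 'e \<Rightarrow> 3 \<Rightarrow> real vec" where
  "velocity_rhs G v \<sigma> e i =
     - vsum (ndof G e) (\<lambda>j. transpose_mat (stiff G e j) *\<^sub>v \<sigma> e i j) UNIV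
     + vsum (ndof G e)
         (\<lambda>m. transpose_mat (projection G m e) *\<^sub>v (W G m *\<^sub>v T_star_e G v \<sigma> m e i))
         (mortars_of G e)"

definition stress_rhs ::
  "('e, 'm, 'x, 'y) dg_scheme \<Rightarrow> 'e velocity \<Rightarrow> 'e stress \<Rightarrow> 'e \<Rightarrow> 3 \<Rightarrow> 3 \<Rightarrow> real vec" where
  "stress_rhs G v \<sigma> e i j =
     (1/2) \<cdot>\<^sub>v (stiff G e j *\<^sub>v v e i + stiff G e i *\<^sub>v v e j)
     + vsum (ndof G e)
         (\<lambda>m. transpose_mat (projection_n G m e j) *\<^sub>v
                (W G m *\<^sub>v (v_star G v \<sigma> m i - v_side G v m e i)))
         (mortars_of G e)"

definition mass_S_apply ::
  "('e, 'm, 'x, 'y) dg_scheme \<Rightarrow> 'e \<Rightarrow> (3 \<Rightarrow> 3 \<Rightarrow> real vec) \<Rightarrow> 3 \<Rightarrow> 3 \<Rightarrow> real vec" where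
  "mass_S_apply G e \<tau> i j =
     vsum (ndof G e) (\<lambda>(k, l). mass_S G e i j k l *\<^sub>v \<tau> k l) UNIV"

definition time_interval :: "real set \<Rightarrow> bool" where
  "time_interval I \<longleftrightarrow> is_interval I \<and> (\<exists>s\<in>I. \<exists>t\<in>I. s < t)"

text \<open>Time derivatives are taken within \<open>I\<close>, hence one-sided at its end points.\<close>

definition ddt :: "real set \<Rightarrow> nat \<Rightarrow> (real \<Rightarrow> real vec) \<Rightarrow> real \<Rightarrow> real vec" where
  "ddt I N f t = Matrix.vec N (\<lambda>a. vector_derivative (\<lambda>s. f s $ a) (at t within I))"

definition differentiable_vec :: "real set \<Rightarrow> nat \<Rightarrow> (real \<Rightarrow> real vec) \<Rightarrow> bool" where
  "differentiable_vec I N f \<longleftrightarrow>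
     (\<forall>t\<in>I. f t \<in> carrier_vec N) \<and> (\<forall>a<N. (\<lambda>s. f s $ a) differentiable_on I)"

definition dg_solution ::
  "('e, 'm, 'x, 'y) dg_scheme \<Rightarrow> real set \<Rightarrow> (real \<Rightarrow> 'e velocity) \<Rightarrow> (real \<Rightarrow> 'e stress) \<Rightarrow> bool" where
  "dg_solution G I v \<sigma> \<longleftrightarrow>
     (\<forall>e\<in>elements G.
        (\<forall>i. differentiable_vec I (ndof G e) (\<lambda>t. v t e i)) \<and>
        (\<forall>i j. differentiable_vec I (ndof G e) (\<lambda>t. \<sigma> t e i j)) \<and>
        (\<forall>t\<in>I. sym_coll (ndof G e) (\<sigma> t e)) \<and>
        (\<forall>t\<in>I. \<forall>i.
           mass_rho G e *\<^sub>v ddt I (ndof G e) (\<lambda>s. v s e i) t = velocity_rhs G (v t) (\<sigma> t) e i) \<and>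
        (\<forall>t\<in>I. \<forall>\<psi>. sym_coll (ndof G e) \<psi> \<longrightarrow>
           (\<Sum>i\<in>UNIV. \<Sum>j\<in>UNIV.
              \<psi> i j \<bullet> mass_S_apply G e (\<lambda>k l. ddt I (ndof G e) (\<lambda>s. \<sigma> s e k l) t) i j) =
           (\<Sum>i\<in>UNIV. \<Sum>j\<in>UNIV. \<psi> i j \<bullet> stress_rhs G (v t) (\<sigma> t) e i j)))"


subsection \<open>Constraints\<close>

definition approximation_consistent :: "('e, 'm, 'x, 'y) dg_scheme \<Rightarrow> bool" where
  "approximation_consistent G \<longleftrightarrow>
     (\<forall>e\<in>elements G. \<exists>c.
        represents (ndof G e) (basis_fun G e) (ref_element G e) c (\<lambda>_. 1)) \<and>
     (\<forall>m\<in>mortars G. \<exists>c.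
        represents (mortar_ndof G m) (mortar_basis_fun G m) (ref_mortar G m) c (\<lambda>_. 1))"

definition projection_consistent :: "('e, 'm, 'x, 'y) dg_scheme \<Rightarrow> bool" where
  "projection_consistent G \<longleftrightarrow>
     (\<forall>m\<in>mortars G.
        vsum (nquad G m) (\<lambda>e. projection G m e *\<^sub>v one_elem G e) (minus_side G m) = one_mortar G m \<and>
        vsum (nquad G m) (\<lambda>e. projection G m e *\<^sub>v one_elem G e) (plus_side G m) = one_mortar G m)"

definition stiffness_consistent :: "('e, 'm, 'x, 'y) dg_scheme \<Rightarrow> bool" where
  "stiffness_consistent G \<longleftrightarrow>
     (\<forall>e\<in>elements G. \<forall>j. stiff G e j *\<^sub>v one_elem G e = 0\<^sub>v (ndof G e))"

definition flux_consistent :: "('e, 'm, 'x, 'y) dg_scheme \<Rightarrow> bool" where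
  "flux_consistent G \<longleftrightarrow>
     (\<forall>m\<in>mortars G. \<forall>n<nquad G m. \<forall>vp vm Tp Tm.
        vp = vm \<and> Tp = Tm \<longrightarrow> flux G m n (vp, vm, Tp, Tm) = (Tp, vp))"

definition discrete_divergence :: "('e, 'm, 'x, 'y) dg_scheme \<Rightarrow> bool" where
  "discrete_divergence G \<longleftrightarrow>
     (\<forall>e\<in>elements G. \<forall>j.
        transpose_mat (stiff G e j) *\<^sub>v one_elem G e =
        vsum (ndof G e)
          (\<lambda>m. transpose_mat (projection G m e) *\<^sub>v (W G m *\<^sub>v normal_e G m e j))
          (mortars_of G e))"

definition constant_traction_consistent :: "('e, 'm, 'x, 'y) dg_scheme \<Rightarrow> bool" where
  "constant_traction_consistent G \<longleftrightarrow>
     (\<forall>m\<in>mortars G. \<forall>(c :: 3 \<Rightarrow> 3 \<Rightarrow> real) \<sigma>.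
        (\<forall>i j. c i j = c j i) \<and>
        (\<forall>e\<in>elements_of G m. \<forall>i j. \<sigma> e i j = c i j \<cdot>\<^sub>v one_elem G e) \<longrightarrow>
        (\<forall>i. T_minus G \<sigma> m i = T_plus G \<sigma> m i \<and>
             T_plus G \<sigma> m i = vsum (nquad G m) (\<lambda>j. c i j \<cdot>\<^sub>v normal G m j) UNIV))"

definition constant_state ::
  "('e, 'm, 'x, 'y) dg_scheme \<Rightarrow> (3 \<Rightarrow> real) \<Rightarrow> (3 \<Rightarrow> 3 \<Rightarrow> real) \<Rightarrow> 'e velocity \<Rightarrow> 'e stress \<Rightarrow> bool" where
  "constant_state G \<beta> \<alpha> v \<sigma> \<longleftrightarrow>
     (\<forall>e\<in>elements G. (\<forall>i. v e i = \<beta> i \<cdot>\<^sub>v one_elem G e) \<and>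
                      (\<forall>i j. \<sigma> e i j = \<alpha> i j \<cdot>\<^sub>v one_elem G e))"

text \<open>
  Local Lipschitz continuity of the numerical flux.  It is used only for the assertion that every
  solution starting from a constant state stays there: for a flux that is merely consistent, for
  instance one with a square root of the jump, the initial value problem may have several
  solutions.
\<close>

definition flux_locally_lipschitz :: "('e, 'm, 'x, 'y) dg_scheme \<Rightarrow> bool" where
  "flux_locally_lipschitz G \<longleftrightarrow>
     (\<forall>m\<in>mortars G. \<forall>n<nquad G m. \<forall>z. \<exists>u>0. \<exists>L. L-lipschitz_on (cball z u) (flux G m n))"

end

theory Submission
  imports Defs "HOL-Library.Landau_Symbols"
begin

text \<open>
  On a constant state, projection consistency makes both velocity states of a mortar equal to
  \<open>\<beta>\<^sub>i\<close> times the constant one, and traction consistency makes both traction states equal to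
  \<open>\<alpha>\<^sub>i\<^sub>j n\<^sub>j\<close>.  A consistent flux returns these common values.  Hence every velocity jump in the stress
  equation vanishes, and the volume term vanishes because the stiffness matrices annihilate constants.
  In the velocity equation the volume term is \<open>- \<alpha>\<^sub>i\<^sub>j S\<^sub>j\<^sup>T 1\<close> and the mortar term is \<open>\<alpha>\<^sub>i\<^sub>j\<close> times the
  mortar sum of the discrete divergence theorem, so they cancel (\<open>velocity_rhs_constant\<close>,
  \<open>stress_rhs_constant\<close>).  The time derivatives themselves then vanish because the mass forms are
  positive definite; for the stress one tests with the time derivative of the stress, which is symmetric.

  A zero derivative at one instant does not by itself keep a solution constant.  For a locally Lipschitz
  flux this is a uniqueness statement, proved by an energy argument.  Let \<open>E\<close> be the sum over the elements
  of the quadratic mass forms of the deviations of velocity and stress from the constant state.  Testing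
  the stress equation with the stress deviation gives \<open>E' = 2\<close> times the pairing of the deviations with
  the right-hand sides (\<open>energy_has_derivative\<close>), so no mass matrix has to be inverted.  The forms are
  coercive (\<open>energy_coercive\<close>), hence the deviations are \<open>O(sqrt E)\<close>.  The right-hand sides vanish at the
  constant state and are locally Lipschitz, so they are \<open>O(sqrt E)\<close> too near every zero of \<open>E\<close>
  (\<open>near_rhs\<close>), and therefore \<open>E' = O(E)\<close> there.  A Gronwall argument started at the last zero of \<open>E\<close>
  (\<open>zero_if_locally_gronwall\<close>) shows that \<open>E\<close> stays zero.
\<close>


section \<open>Vectors, matrices and bilinear forms\<close>

lemma mult_mat_vec_index_sum:
  fixes A :: "real mat"
  assumes "A \<in> carrier_mat nr nc" "v \<in> carrier_vec nc" "i < nr"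
  shows "(A *\<^sub>v v) $ i = (\<Sum>b<nc. A $$ (i, b) * v $ b)"
  using assms by (auto simp: scalar_prod_def atLeast0LessThan intro!: sum.cong)

lemma scalar_prod_index_sum:
  fixes w :: "real vec"
  assumes "w \<in> carrier_vec n"
  shows "v \<bullet> w = (\<Sum>a<n. v $ a * w $ a)"
  using assms by (auto simp: scalar_prod_def atLeast0LessThan)

lemma smult_vec_index: "v \<in> carrier_vec n \<Longrightarrow> a < n \<Longrightarrow> (r \<cdot>\<^sub>v v) $ a = r * v $ a"
  by simp

lemma mult_mat_vec_zero_right:
  fixes A :: "real mat"
  assumes "A \<in> carrier_mat n n"
  shows "A *\<^sub>v 0\<^sub>v n = 0\<^sub>v n"
  using assms by (intro eq_vecI) (auto simp: scalar_prod_def)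

lemma vsum_carrier:
  assumes "\<And>x. x \<in> X \<Longrightarrow> f x \<in> carrier_vec n"
  shows "vsum n f X \<in> carrier_vec n"
  using assms by (intro finsum_vec_closed) auto

lemma vsum_index:
  assumes "finite X" "\<And>x. x \<in> X \<Longrightarrow> f x \<in> carrier_vec n" "a < n"
  shows "vsum n f X $ a = (\<Sum>x\<in>X. f x $ a)"
  using assms by (intro index_finsum_vec) auto

lemma vsum_cong:
  assumes "finite X" "\<And>x. x \<in> X \<Longrightarrow> f x = h x" "\<And>x. x \<in> X \<Longrightarrow> h x \<in> carrier_vec n"
  shows "vsum n f X = vsum n h X"
proof -
  have "vsum n f X \<in> carrier_vec n" "vsum n h X \<in> carrier_vec n"
    using assms by (auto intro!: vsum_carrier)
  thus ?thesis
    using assms by (intro eq_vecI) (auto simp: vsum_index)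
qed

lemma vsum_smult:
  assumes "finite X" "\<And>x. x \<in> X \<Longrightarrow> f x \<in> carrier_vec n"
  shows "vsum n (\<lambda>x. r \<cdot>\<^sub>v f x) X = r \<cdot>\<^sub>v vsum n f X"
proof -
  have "vsum n (\<lambda>x. r \<cdot>\<^sub>v f x) X \<in> carrier_vec n" "vsum n f X \<in> carrier_vec n"
    using assms by (auto intro!: vsum_carrier)
  thus ?thesis
    using assms by (intro eq_vecI) (auto simp: vsum_index sum_distrib_left  intro!: sum.cong smult_vec_index)
qed

lemma mult_mat_vsum_index:
  assumes "A \<in> carrier_mat nr nc" "finite X" "\<And>x. x \<in> X \<Longrightarrow> f x \<in> carrier_vec nc" "i < nr"
  shows "(A *\<^sub>v vsum nc f X) $ i = (\<Sum>x\<in>X. (A *\<^sub>v f x) $ i)"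
proof -
  have "(A *\<^sub>v vsum nc f X) $ i = (\<Sum>b<nc. \<Sum>x\<in>X. A $$ (i, b) * f x $ b)"
    using assms by (subst mult_mat_vec_index_sum[OF assms(1) vsum_carrier])
      (auto simp: vsum_index sum_distrib_left intro!: sum.cong)
  also have "\<dots> = (\<Sum>x\<in>X. (A *\<^sub>v f x) $ i)"
    using assms by (subst sum.swap) (auto simp: mult_mat_vec_index_sum[OF assms(1)] simp del: index_mult_mat_vec intro!: sum.cong)
  finally show ?thesis .
qed

lemma scalar_prod_vsum:
  assumes "finite X" "\<And>x. x \<in> X \<Longrightarrow> f x \<in> carrier_vec n"
  shows "u \<bullet> vsum n f X = (\<Sum>x\<in>X. u \<bullet> f x)"
proof -
  have "u \<bullet> vsum n f X = (\<Sum>a<n. \<Sum>x\<in>X. u $ a * f x $ a)"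
    using assms by (subst scalar_prod_index_sum[OF vsum_carrier])
      (auto simp: vsum_index sum_distrib_left intro!: sum.cong)
  also have "\<dots> = (\<Sum>x\<in>X. u \<bullet> f x)"
    by (subst sum.swap) (intro sum.cong refl scalar_prod_index_sum[symmetric] assms(2))
  finally show ?thesis .
qed

lemma bilinear_form_sum:
  fixes A :: "real mat"
  assumes "A \<in> carrier_mat n n" "w \<in> carrier_vec n"
  shows "u \<bullet> (A *\<^sub>v w) = (\<Sum>a<n. \<Sum>b<n. A $$ (a, b) * (u $ a * w $ b))"
  using assms by (subst scalar_prod_index_sum[of _ n])
    (auto simp: mult_mat_vec_index_sum sum_distrib_left mult.left_commute simp del: index_mult_mat_vec intro!: sum.cong)

lemma bilinear_form_zero:
  fixes A :: "real mat"
  assumes "A \<in> carrier_mat n n"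
  shows "0\<^sub>v n \<bullet> (A *\<^sub>v w) = 0"
  using assms by (simp add: scalar_prod_def)

lemma bilinear_form_scale:
  fixes A :: "real mat"
  assumes "A \<in> carrier_mat n n"
  shows "Matrix.vec n (\<lambda>a. r * u a) \<bullet> (A *\<^sub>v Matrix.vec n (\<lambda>a. r * w a)) =
    r\<^sup>2 * (Matrix.vec n u \<bullet> (A *\<^sub>v Matrix.vec n w))"
  using assms
  by (subst (1 2) bilinear_form_sum) (auto simp: sum_distrib_left power2_eq_square mult_ac intro!: sum.cong)

lemma bilinear_form_symmetric:
  fixes A :: "real mat"
  assumes A: "A \<in> carrier_mat n n" "transpose_mat A = A"
    and "u \<in> carrier_vec n" "w \<in> carrier_vec n"
  shows "u \<bullet> (A *\<^sub>v w) = w \<bullet> (A *\<^sub>v u)"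
proof -
  have "A $$ (a, b) = A $$ (b, a)" if "a < n" "b < n" for a b
    using arg_cong[OF A(2), of "\<lambda>B. B $$ (a, b)"] that A(1) by simp
  hence "(\<Sum>a<n. \<Sum>b<n. A $$ (a, b) * (u $ a * w $ b)) = (\<Sum>a<n. \<Sum>b<n. A $$ (b, a) * (w $ b * u $ a))"
    by (intro sum.cong) auto
  also have "\<dots> = (\<Sum>b<n. \<Sum>a<n. A $$ (b, a) * (w $ b * u $ a))"
    by (rule sum.swap)
  finally show ?thesis
    using assms by (simp add: bilinear_form_sum del: index_mult_mat_vec)
qed

lemma bilinear_form_has_derivative:
  fixes A :: "real mat"
  assumes A: "A \<in> carrier_mat n n"
    and u: "\<And>t. t \<in> I \<Longrightarrow> u t \<in> carrier_vec n" and w: "\<And>t. t \<in> I \<Longrightarrow> w t \<in> carrier_vec n"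
    and w': "w' \<in> carrier_vec n"
    and du: "\<And>a. a < n \<Longrightarrow> ((\<lambda>t. u t $ a) has_real_derivative u' $ a) (at t within I)"
    and dw: "\<And>a. a < n \<Longrightarrow> ((\<lambda>t. w t $ a) has_real_derivative w' $ a) (at t within I)"
    and t: "t \<in> I"
  shows "((\<lambda>t. u t \<bullet> (A *\<^sub>v w t)) has_real_derivative u' \<bullet> (A *\<^sub>v w t) + u t \<bullet> (A *\<^sub>v w')) (at t within I)"
proof -
  have "((\<lambda>t. \<Sum>a<n. \<Sum>b<n. A $$ (a, b) * (u t $ a * w t $ b)) has_real_derivative
      (\<Sum>a<n. \<Sum>b<n. A $$ (a, b) * (u' $ a * w t $ b + u t $ a * w' $ b))) (at t within I)"
    by (auto intro!: derivative_eq_intros sum.cong du[simplified] dw[simplified] simp: algebra_simps)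
  also have "(\<Sum>a<n. \<Sum>b<n. A $$ (a, b) * (u' $ a * w t $ b + u t $ a * w' $ b)) =
      u' \<bullet> (A *\<^sub>v w t) + u t \<bullet> (A *\<^sub>v w')"
    using A w[OF t] w' by (simp add: bilinear_form_sum sum.distrib distrib_left)
  finally show ?thesis
    by (rule has_field_derivative_transform_within[where d = 1])
       (simp_all add: bilinear_form_sum[OF A w] t)
qed

lemma continuous_on_bilinear_form:
  fixes S :: "'a::t2_space set" and A :: "real mat"
  assumes "A \<in> carrier_mat n n"
    and "\<And>a. a < n \<Longrightarrow> continuous_on S (\<lambda>x. u x a)" "\<And>a. a < n \<Longrightarrow> continuous_on S (\<lambda>x. w x a)"
  shows "continuous_on S (\<lambda>x. Matrix.vec n (u x) \<bullet> (A *\<^sub>v Matrix.vec n (w x)))"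
proof -
  have "continuous_on S (\<lambda>x. \<Sum>a<n. \<Sum>b<n. A $$ (a, b) * (u x a * w x b))"
    using assms(2,3) by (intro continuous_on_sum continuous_on_mult continuous_on_const) auto
  thus ?thesis
    by (simp add: bilinear_form_sum[OF assms(1)])
qed

section \<open>Time derivatives of vectors\<close>

lemma differentiable_vec_has_derivative:
  assumes "differentiable_vec I n f" "t \<in> I" "a < n"
  shows "((\<lambda>s. f s $ a) has_real_derivative ddt I n f t $ a) (at t within I)"
  using assms unfolding differentiable_vec_def differentiable_on_def ddt_def
  by (simp add: has_real_derivative_iff_has_vector_derivative vector_derivative_works)

lemma ddt_carrier [simp]: "ddt I n f t \<in> carrier_vec n"
  by (simp add: ddt_def)

lemma ddt_cong:
  assumes "\<And>s. s \<in> I \<Longrightarrow> f s = g s" "t \<in> I"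
  shows "ddt I n f t = ddt I n g t"
proof -
  have "vector_derivative (\<lambda>s. f s $ a) (at t within I) = vector_derivative (\<lambda>s. g s $ a) (at t within I)" for a
    using assms by (intro vector_derivative_cong_eq) auto
  thus ?thesis by (simp add: ddt_def)
qed

text \<open>
  A derivative within \<open>I\<close> is determined only at limit points of \<open>I\<close>; this is where the
  nondegeneracy of the time interval enters.
\<close>

lemma ddt_const:
  assumes "time_interval I" "t \<in> I"
  shows "ddt I n (\<lambda>_. c) t = 0\<^sub>v n"
proof -
  have "connected I" "\<nexists>x. I = {x}"
    using assms by (auto simp: time_interval_def is_interval_connected)
  hence "at t within I \<noteq> bot"
    using connected_imp_perfect[of I t] assms(2) by (simp add: trivial_limit_within)
  hence "vector_derivative (\<lambda>_. c $ a) (at t within I) = 0" for a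
    by (intro vector_derivative_within) auto
  thus ?thesis by (auto simp: ddt_def)
qed

section \<open>A local Gronwall criterion and coercivity of definite forms\<close>

text \<open>
  If \<open>E b\<close> were nonzero, there would be a last zero \<open>s < b\<close> of \<open>E\<close>.  Just after \<open>s\<close> the bound
  \<open>\<bar>E'\<bar> \<le> K E\<close> makes \<open>E t * exp (- K * t)\<close> nonincreasing, so \<open>E\<close> would remain zero beyond \<open>s\<close>.
  The bound is needed only near zeros of \<open>E\<close>, with a constant depending on the zero, so it suffices
  to control the flux near the constant state, not along the whole trajectory.
\<close>

lemma zero_if_locally_gronwall:
  fixes E E' :: "real \<Rightarrow> real"
  assumes "a \<le> b" and E0: "E a = 0"
    and nonneg: "\<And>t. t \<in> {a..b} \<Longrightarrow> E t \<ge> 0"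
    and der: "\<And>t. t \<in> {a..b} \<Longrightarrow> (E has_real_derivative E' t) (at t within {a..b})"
    and bnd: "\<And>s. a \<le> s \<Longrightarrow> s < b \<Longrightarrow> E s = 0 \<Longrightarrow> E' \<in> O[at_right s](E)"
  shows "E b = 0"
proof (rule ccontr)
  assume Eb: "E b \<noteq> 0"
  have cont: "continuous_on {a..b} E"
    using der DERIV_continuous_on by blast
  define Z where "Z = {t \<in> {a..b}. E t = 0}"
  have "closed Z"
    unfolding Z_def using cont by (intro continuous_closed_preimage_constant) auto
  moreover have "Z \<noteq> {}" "bdd_above Z"
    using E0 \<open>a \<le> b\<close> by (auto simp: Z_def intro: bdd_aboveI[of _ b])
  ultimately have "Sup Z \<in> Z" by (rule closed_contains_Sup[rotated -1])
  define s where "s = Sup Z"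
  have s: "a \<le> s" "s < b" "E s = 0"
    using \<open>Sup Z \<in> Z\<close> Eb by (auto simp: s_def Z_def less_le)
  have after: "E t \<noteq> 0" if "s < t" "t \<le> b" for t
  proof
    assume "E t = 0"
    hence "t \<in> Z" using that s by (auto simp: Z_def)
    hence "t \<le> s" unfolding s_def using \<open>bdd_above Z\<close> by (rule cSup_upper)
    thus False using that by simp
  qed
  obtain K where K: "\<forall>\<^sub>F t in at_right s. norm (E' t) \<le> K * norm (E t)"
    using bnd[OF s] by (auto elim!: landau_o.bigE)
  then obtain c where c: "c > s" "\<And>t. s < t \<Longrightarrow> t < c \<Longrightarrow> norm (E' t) \<le> K * norm (E t)"
    unfolding eventually_at_right_field by blast
  define d where "d = (s + min b c) / 2"
  have d: "s < d" "d < b" "d < c" using s c by (auto simp: d_def)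
  have "E d * exp (- K * d) \<le> E s * exp (- K * s)"
  proof (rule DERIV_nonpos_imp_decreasing_open[where f = "\<lambda>t. E t * exp (- K * t)"])
    fix t assume t: "s < t" "t < d"
    have "(E has_real_derivative E' t) (at t within {a..b})"
      using t d s by (intro der) auto
    hence D: "(E has_real_derivative E' t) (at t)"
      using t d s by (subst (asm) at_within_interior) auto
    have "((\<lambda>t. E t * exp (- K * t)) has_real_derivative (E' t - K * E t) * exp (- K * t)) (at t)"
      by (auto intro!: derivative_eq_intros D simp: algebra_simps)
    moreover have "E' t \<le> K * E t"
      using c(2)[of t] nonneg[of t] t d s by (auto simp: abs_le_iff)
    ultimately show "\<exists>y. ((\<lambda>t. E t * exp (- K * t)) has_real_derivative y) (at t) \<and> y \<le> 0"
      by (intro exI conjI) (auto simp: mult_nonpos_nonneg)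
  next
    show "continuous_on {s..d} (\<lambda>t. E t * exp (- K * t))"
      using s d by (intro continuous_intros continuous_on_subset[OF cont]) auto
  qed (use d in simp)
  hence "E d \<le> 0" using s by (simp add: mult_le_0_iff)
  with nonneg[of d] after[of d] s d show False by auto
qed

text \<open>
  The unit sphere of \<open>V\<close> is compact because its elements are supported in a finite set.  The form has a
  positive minimum on it, and homogeneity carries this bound to all of \<open>V\<close>.  Functions on an
  index set stand in for vectors here, so that dimensions may vary from element to element; \<open>V\<close> is a
  closed cone so that it can express the symmetry of a stress.
\<close>

lemma quadratic_coercive:
  fixes q :: "('i \<Rightarrow> real) \<Rightarrow> real" and V :: "('i \<Rightarrow> real) set"
  assumes fin: "finite J"
    and cont: "continuous_on UNIV q"
    and hom: "\<And>r x. q (\<lambda>a. r * x a) = r\<^sup>2 * q x"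
    and V: "closed V" "\<And>r x. x \<in> V \<Longrightarrow> (\<lambda>a. r * x a) \<in> V"
    and supp: "\<And>x a. x \<in> V \<Longrightarrow> a \<notin> J \<Longrightarrow> x a = 0"
    and pos: "\<And>x. x \<in> V \<Longrightarrow> x \<noteq> (\<lambda>_. 0) \<Longrightarrow> q x > 0"
  obtains c where "c > 0" "\<And>x. x \<in> V \<Longrightarrow> c * (\<Sum>a\<in>J. (x a)\<^sup>2) \<le> q x"
proof -
  define n where "n = (\<lambda>x::'i \<Rightarrow> real. \<Sum>a\<in>J. (x a)\<^sup>2)"
  have contn: "continuous_on UNIV n"
    unfolding n_def by (intro continuous_intros continuous_on_product_coordinates)
  define B where "B = (\<Pi>\<^sub>E a\<in>UNIV. if a \<in> J then {-1..1::real} else {0})"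
  have "compactin (product_topology (\<lambda>_. euclidean) UNIV) B"
    unfolding B_def compactin_PiE by auto
  hence "compact B"
    unfolding euclidean_product_topology by simp
  define K where "K = B \<inter> (V \<inter> n -` {1})"
  have "closed (n -` {1})"
    by (intro closed_vimage contn closed_singleton)
  hence "compact K"
    unfolding K_def using \<open>compact B\<close> V(1) by (intro compact_Int_closed closed_Int)
  have n_pos: "n x > 0" and unit: "(\<lambda>a. x a / sqrt (n x)) \<in> K"
    if x: "x \<in> V" "x \<noteq> (\<lambda>_. 0)" for x
  proof -
    obtain a where a: "x a \<noteq> 0" using x(2) by auto
    with supp x(1) have "a \<in> J" by blast
    with a fin show "n x > 0" unfolding n_def by (intro sum_pos2[of _ a]) auto
    have "n (\<lambda>a. x a / sqrt (n x)) = (\<Sum>a\<in>J. (x a)\<^sup>2) / n x"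
      using \<open>n x > 0\<close> by (subst n_def) (simp add: power_divide sum_divide_distrib)
    hence one: "n (\<lambda>a. x a / sqrt (n x)) = 1"
      using \<open>n x > 0\<close> by (simp add: n_def)
    have "\<bar>x b / sqrt (n x)\<bar> \<le> 1" if "b \<in> J" for b
    proof -
      have "(x b / sqrt (n x))\<^sup>2 \<le> n (\<lambda>a. x a / sqrt (n x))"
        using member_le_sum[of b J "\<lambda>a. (x a / sqrt (n x))\<^sup>2"] fin that
        by (subst n_def) simp
      thus ?thesis using one by (simp add: abs_square_le_1)
    qed
    hence "- 1 \<le> x b / sqrt (n x) \<and> x b / sqrt (n x) \<le> 1" if "b \<in> J" for b
      using that by (metis abs_le_iff minus_le_iff)
    hence "(\<lambda>a. x a / sqrt (n x)) \<in> B"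
      unfolding B_def using supp[OF x(1)] by (auto simp: PiE_iff)
    moreover have "(\<lambda>a. x a / sqrt (n x)) \<in> V"
      using V(2)[OF x(1), of "1 / sqrt (n x)"] by simp
    ultimately show "(\<lambda>a. x a / sqrt (n x)) \<in> K" using one by (simp add: K_def)
  qed
  obtain c where c: "c > 0" "\<And>x. x \<in> K \<Longrightarrow> c \<le> q x"
  proof (cases "K = {}")
    case True
    thus ?thesis using that[of 1] by auto
  next
    case False
    obtain y where y: "y \<in> K" "\<And>x. x \<in> K \<Longrightarrow> q y \<le> q x"
      using continuous_attains_inf[OF \<open>compact K\<close> False continuous_on_subset[OF cont]] by auto
    have "y \<noteq> (\<lambda>_. 0)" using y(1) by (auto simp: K_def n_def)
    with y pos show ?thesis by (intro that[of "q y"]) (auto simp: K_def)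
  qed
  show ?thesis
  proof (rule that[OF c(1)])
    fix x assume x: "x \<in> V"
    show "c * (\<Sum>a\<in>J. (x a)\<^sup>2) \<le> q x"
    proof (cases "x = (\<lambda>_. 0)")
      case True
      thus ?thesis using hom[of 0 x] by simp
    next
      case False
      have "c \<le> q (\<lambda>a. (1 / sqrt (n x)) * x a)" using c(2)[OF unit[OF x False]] by simp
      also have "\<dots> = q x / n x" using n_pos[OF x False] by (subst hom) (simp add: power_divide)
      finally show ?thesis using n_pos[OF x False] by (simp add: field_simps n_def)
    qed
  qed
qed

section \<open>Vectors tending to a limit at a given rate\<close>

text \<open>
  Entrywise \<open>u - w = O(g)\<close>.  Dimensions are required only eventually, since a solution is constrained
  only at times in its interval.  All operators of the scheme except the flux are linear, so this
  relation passes through them by the closure rules below.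
\<close>

definition near :: "'t filter \<Rightarrow> ('t \<Rightarrow> real) \<Rightarrow> nat \<Rightarrow> ('t \<Rightarrow> real vec) \<Rightarrow> real vec \<Rightarrow> bool" where
  "near F g n u w \<longleftrightarrow> w \<in> carrier_vec n \<and> (\<forall>\<^sub>F t in F. u t \<in> carrier_vec n) \<and>
     (\<forall>a<n. (\<lambda>t. u t $ a - w $ a) \<in> O[F](g))"

lemma nearI:
  assumes "w \<in> carrier_vec n" "\<forall>\<^sub>F t in F. u t \<in> carrier_vec n"
    and "\<And>a. a < n \<Longrightarrow> d a \<in> O[F](g)"
    and "\<And>a. a < n \<Longrightarrow> \<forall>\<^sub>F t in F. u t $ a - w $ a = d a t"
  shows "near F g n u w"
  using assms(1-3) landau_o.big.in_cong[OF assms(4)] by (auto simp: near_def)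

lemma near_const: "w \<in> carrier_vec n \<Longrightarrow> near F g n (\<lambda>_. w) w"
  by (simp add: near_def)

lemma near_vec:
  assumes "\<And>a. a < n \<Longrightarrow> (\<lambda>t. f t a - h a) \<in> O[F](g)"
  shows "near F g n (\<lambda>t. Matrix.vec n (f t)) (Matrix.vec n h)"
  using assms by (auto simp: near_def)

lemma near_bigo: "near F g n u w \<Longrightarrow> a < n \<Longrightarrow> (\<lambda>t. u t $ a - w $ a) \<in> O[F](g)"
  by (simp add: near_def)

lemma near_carrier:
  assumes "near F g n u w"
  shows "w \<in> carrier_vec n" "\<forall>\<^sub>F t in F. u t \<in> carrier_vec n"
  using assms by (auto simp: near_def)

lemma near_add:
  assumes "near F g n u w" "near F g n u' w'"
  shows "near F g n (\<lambda>t. u t + u' t) (w + w')"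
proof (rule nearI)
  note c = near_carrier[OF assms(1)] near_carrier[OF assms(2)]
  show "w + w' \<in> carrier_vec n" using c by simp
  show "\<forall>\<^sub>F t in F. u t + u' t \<in> carrier_vec n" using c(2,4) by eventually_elim simp
  fix a assume a: "a < n"
  show "(\<lambda>t. (u t $ a - w $ a) + (u' t $ a - w' $ a)) \<in> O[F](g)"
    by (intro sum_in_bigo(1) near_bigo[OF assms(1) a] near_bigo[OF assms(2) a])
  show "\<forall>\<^sub>F t in F. (u t + u' t) $ a - (w + w') $ a = (u t $ a - w $ a) + (u' t $ a - w' $ a)"
    using c(2,4) by eventually_elim (use a c in auto)
qed

lemma near_smult:
  assumes "near F g n u w"
  shows "near F g n (\<lambda>t. r \<cdot>\<^sub>v u t) (r \<cdot>\<^sub>v w)"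
proof (rule nearI)
  note c = near_carrier[OF assms(1)]
  show "r \<cdot>\<^sub>v w \<in> carrier_vec n" using c by simp
  show "\<forall>\<^sub>F t in F. r \<cdot>\<^sub>v u t \<in> carrier_vec n" using c(2) by eventually_elim simp
  fix a assume a: "a < n"
  show "(\<lambda>t. r * (u t $ a - w $ a)) \<in> O[F](g)"
    using near_bigo[OF assms a] by simp
  show "\<forall>\<^sub>F t in F. (r \<cdot>\<^sub>v u t) $ a - (r \<cdot>\<^sub>v w) $ a = r * (u t $ a - w $ a)"
    using c(2) by eventually_elim (use a c in \<open>auto simp: algebra_simps\<close>)
qed

lemma near_uminus:
  assumes "near F g n u w"
  shows "near F g n (\<lambda>t. - u t) (- w)"
proof (rule nearI)
  note c = near_carrier[OF assms(1)]
  show "- w \<in> carrier_vec n" using c by simp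
  show "\<forall>\<^sub>F t in F. - u t \<in> carrier_vec n" using c(2) by eventually_elim simp
  fix a assume a: "a < n"
  show "(\<lambda>t. (- 1) * (u t $ a - w $ a)) \<in> O[F](g)"
    using near_bigo[OF assms a] by (subst landau_o.big.cmult_in_iff) auto
  show "\<forall>\<^sub>F t in F. (- u t) $ a - (- w) $ a = (- 1) * (u t $ a - w $ a)"
    using c(2) by eventually_elim (use a c in auto)
qed

lemma near_diff:
  assumes "near F g n u w" "near F g n u' w'"
  shows "near F g n (\<lambda>t. u t - u' t) (w - w')"
proof (rule nearI)
  note c = near_carrier[OF assms(1)] near_carrier[OF assms(2)]
  show "w - w' \<in> carrier_vec n" using c by simp
  show "\<forall>\<^sub>F t in F. u t - u' t \<in> carrier_vec n" using c(2,4) by eventually_elim simp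
  fix a assume a: "a < n"
  show "(\<lambda>t. (u t $ a - w $ a) - (u' t $ a - w' $ a)) \<in> O[F](g)"
    by (intro sum_in_bigo(2) near_bigo[OF assms(1) a] near_bigo[OF assms(2) a])
  show "\<forall>\<^sub>F t in F. (u t - u' t) $ a - (w - w') $ a = (u t $ a - w $ a) - (u' t $ a - w' $ a)"
    using c(2,4) by eventually_elim (use a c in auto)
qed

lemma near_mult_mat:
  assumes A: "A \<in> carrier_mat n k" and "near F g k u w"
  shows "near F g n (\<lambda>t. A *\<^sub>v u t) (A *\<^sub>v w)"
proof (rule nearI)
  note c = near_carrier[OF assms(2)]
  show "A *\<^sub>v w \<in> carrier_vec n" using A c(1) by auto
  show "\<forall>\<^sub>F t in F. A *\<^sub>v u t \<in> carrier_vec n"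
    using c(2) by eventually_elim (use A in auto)
  fix a assume a: "a < n"
  show "(\<lambda>t. \<Sum>b<k. A $$ (a, b) * (u t $ b - w $ b)) \<in> O[F](g)"
    using near_bigo[OF assms(2)] by (intro big_sum_in_bigo) auto
  show "\<forall>\<^sub>F t in F. (A *\<^sub>v u t) $ a - (A *\<^sub>v w) $ a = (\<Sum>b<k. A $$ (a, b) * (u t $ b - w $ b))"
    using c(2) by eventually_elim
      (use a c A in \<open>auto simp: mult_mat_vec_index_sum sum_subtractf[symmetric] right_diff_distrib
          intro!: sum.cong simp del: index_mult_mat_vec\<close>)
qed

lemma near_vsum:
  assumes X: "finite X" and near: "\<And>x. x \<in> X \<Longrightarrow> near F g n (\<lambda>t. u t x) (w x)"
  shows "near F g n (\<lambda>t. vsum n (u t) X) (vsum n w X)"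
proof (rule nearI)
  note c = near_carrier[OF near]
  have ev: "\<forall>\<^sub>F t in F. \<forall>x\<in>X. u t x \<in> carrier_vec n"
    using c X by (intro eventually_ball_finite) auto
  show "vsum n w X \<in> carrier_vec n" using c by (intro vsum_carrier)
  show "\<forall>\<^sub>F t in F. vsum n (u t) X \<in> carrier_vec n"
    using ev by eventually_elim (intro vsum_carrier, auto)
  fix a assume a: "a < n"
  show "(\<lambda>t. \<Sum>x\<in>X. u t x $ a - w x $ a) \<in> O[F](g)"
    using near_bigo[OF near a] by (intro big_sum_in_bigo)
  show "\<forall>\<^sub>F t in F. vsum n (u t) X $ a - vsum n w X $ a = (\<Sum>x\<in>X. u t x $ a - w x $ a)"
    using ev by eventually_elim (use a c X in \<open>auto simp: vsum_index sum_subtractf\<close>)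
qed

lemma near_scalar_prod_zero:
  assumes "near F g n u (0\<^sub>v n)" "near F g n w (0\<^sub>v n)"
  shows "(\<lambda>t. u t \<bullet> w t) \<in> O[F](\<lambda>t. g t * g t)"
proof -
  have "\<forall>\<^sub>F t in F. u t \<bullet> w t = (\<Sum>a<n. (u t $ a - 0\<^sub>v n $ a) * (w t $ a - 0\<^sub>v n $ a))"
    using near_carrier(2)[OF assms(2)] by eventually_elim (auto simp: scalar_prod_index_sum)
  moreover have "(\<lambda>t. \<Sum>a<n. (u t $ a - 0\<^sub>v n $ a) * (w t $ a - 0\<^sub>v n $ a)) \<in> O[F](\<lambda>t. g t * g t)"
    by (intro big_sum_in_bigo landau_o.big.mult near_bigo[OF assms(1)] near_bigo[OF assms(2)]) auto
  ultimately show ?thesis by (subst landau_o.big.in_cong)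
qed

section \<open>Consistent schemes\<close>

locale consistent_dg =
  fixes G :: "('e, 'm, 'x::euclidean_space, 'y::euclidean_space) dg_scheme"
  assumes ok: "dg_ok G"
    and approximation: "approximation_consistent G"
    and projection: "projection_consistent G"
    and stiffness: "stiffness_consistent G"
    and consistent_flux: "flux_consistent G"
    and divergence: "discrete_divergence G"
    and traction: "constant_traction_consistent G"

context consistent_dg
begin

lemma finite_elements [simp]: "finite (elements G)"
  using ok by (simp add: dg_ok_def mesh_ok_def)

lemma finite_mortars_of [simp]: "e \<in> elements G \<Longrightarrow> finite (mortars_of G e)"
  using ok by (auto simp: dg_ok_def mesh_ok_def intro: finite_subset)

lemma mortars_ofD:
  assumes "e \<in> elements G" "m \<in> mortars_of G e"
  shows "m \<in> mortars G" "e \<in> elements_of G m"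
  using assms ok by (auto simp: dg_ok_def mesh_ok_def elements_of_def)

lemma elements_ofD: "e \<in> elements_of G m \<Longrightarrow> e \<in> elements G"
  by (simp add: elements_of_def)

lemma sides:
  assumes "m \<in> mortars G"
  shows "finite (plus_side G m)" "finite (minus_side G m)"
    and "plus_side G m \<subseteq> elements_of G m" "minus_side G m \<subseteq> elements_of G m"
proof -
  have "finite (elements_of G m)" by (simp add: elements_of_def)
  moreover have "elements_of G m = plus_side G m \<union> minus_side G m"
    using ok assms by (auto simp: dg_ok_def mesh_ok_def)
  ultimately show "finite (plus_side G m)" "finite (minus_side G m)"
    "plus_side G m \<subseteq> elements_of G m" "minus_side G m \<subseteq> elements_of G m" by auto
qed

lemma stiff_carrier: "e \<in> elements G \<Longrightarrow> stiff G e j \<in> carrier_mat (ndof G e) (ndof G e)"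
  using ok by (simp add: dg_ok_def operators_ok_def)

lemma projection_carrier:
  assumes "m \<in> mortars G" "e \<in> elements_of G m"
  shows "projection G m e \<in> carrier_mat (nquad G m) (ndof G e)"
    and "projection_n G m e j \<in> carrier_mat (nquad G m) (ndof G e)"
  using ok assms by (auto simp: dg_ok_def operators_ok_def)

lemma mass_rho:
  assumes "e \<in> elements G"
  shows "mass_rho G e \<in> carrier_mat (ndof G e) (ndof G e)"
    and "transpose_mat (mass_rho G e) = mass_rho G e"
    and "p \<in> carrier_vec (ndof G e) \<Longrightarrow> p \<noteq> 0\<^sub>v (ndof G e) \<Longrightarrow> p \<bullet> (mass_rho G e *\<^sub>v p) > 0"
  using ok assms by (auto simp: dg_ok_def mass_rho_ok_def)

lemma mass_S:
  assumes "e \<in> elements G"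
  shows "mass_S G e i j k l \<in> carrier_mat (ndof G e) (ndof G e)"
    and "transpose_mat (mass_S G e i j k l) = mass_S G e i j k l"
    and "mass_S G e i j k l = mass_S G e k l i j"
  using ok assms unfolding dg_ok_def mass_S_ok_def by blast+

lemma mass_S_pos:
  assumes "e \<in> elements G" "sym_coll (ndof G e) s" "\<exists>i j. s i j \<noteq> 0\<^sub>v (ndof G e)"
  shows "(\<Sum>i\<in>UNIV. \<Sum>j\<in>UNIV. \<Sum>k\<in>UNIV. \<Sum>l\<in>UNIV. s i j \<bullet> (mass_S G e i j k l *\<^sub>v s k l)) > 0"
  using ok assms unfolding dg_ok_def mass_S_ok_def by blast

lemma W_carrier: "W G m \<in> carrier_mat (nquad G m) (nquad G m)"
  by (simp add: W_def mat_diag_def)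

lemma normal_carrier: "normal G m j \<in> carrier_vec (nquad G m)" "normal_e G m e j \<in> carrier_vec (nquad G m)"
  by (simp_all add: normal_def normal_e_def)

text \<open>
  The definite description in \<open>one_elem\<close> is meaningful: constants are representable, and uniquely so by
  linear independence of the basis.
\<close>

lemma one_elem_carrier:
  assumes e: "e \<in> elements G"
  shows "one_elem G e \<in> carrier_vec (ndof G e)"
proof -
  let ?rep = "\<lambda>c. represents (ndof G e) (basis_fun G e) (ref_element G e) c (\<lambda>_. 1)"
  obtain c where c: "?rep c"
    using approximation e by (auto simp: approximation_consistent_def)
  have "c' = c" if c': "?rep c'" for c'
  proof -
    have "represents (ndof G e) (basis_fun G e) (ref_element G e) (c' - c) (\<lambda>_. 0)"
      using c c' by (auto simp: represents_def left_diff_distrib sum_subtractf)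
    hence "c' - c = 0\<^sub>v (ndof G e)"
      using ok e unfolding dg_ok_def spaces_ok_def is_basis_on_def by blast
    moreover have "c \<in> carrier_vec (ndof G e)" "c' \<in> carrier_vec (ndof G e)"
      using c c' by (auto simp: represents_def)
    ultimately have "c' $ a - c $ a = 0" if "a < ndof G e" for a
      using that by (metis carrier_vecD index_minus_vec(1) index_zero_vec(1))
    thus "c' = c"
      using \<open>c \<in> _\<close> \<open>c' \<in> _\<close> by (intro eq_vecI) auto
  qed
  hence "?rep (one_elem G e)"
    unfolding one_elem_def using c by (rule theI[rotated])
  thus ?thesis by (simp add: represents_def)
qed

definition S_form :: "'e \<Rightarrow> (3 \<Rightarrow> 3 \<Rightarrow> real vec) \<Rightarrow> real" where
  "S_form e s = (\<Sum>i\<in>UNIV. \<Sum>j\<in>UNIV. \<Sum>k\<in>UNIV. \<Sum>l\<in>UNIV. s i j \<bullet> (mass_S G e i j k l *\<^sub>v s k l))"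

lemma scalar_prod_mass_S_apply:
  assumes e: "e \<in> elements G" and \<tau>: "\<And>k l. \<tau> k l \<in> carrier_vec (ndof G e)"
  shows "p \<bullet> mass_S_apply G e \<tau> i j = (\<Sum>k\<in>UNIV. \<Sum>l\<in>UNIV. p \<bullet> (mass_S G e i j k l *\<^sub>v \<tau> k l))"
proof -
  have "p \<bullet> mass_S_apply G e \<tau> i j = (\<Sum>x\<in>UNIV. p \<bullet> (case x of (k, l) \<Rightarrow> mass_S G e i j k l *\<^sub>v \<tau> k l))"
    unfolding mass_S_apply_def using \<tau> mass_S(1)[OF e]
    by (intro scalar_prod_vsum) (auto intro!: mult_mat_vec_carrier)
  also have "\<dots> = (\<Sum>k\<in>UNIV. \<Sum>l\<in>UNIV. p \<bullet> (mass_S G e i j k l *\<^sub>v \<tau> k l))"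
    unfolding UNIV_Times_UNIV[symmetric] sum.cartesian_product' by simp
  finally show ?thesis .
qed

lemma mass_S_apply_zero:
  assumes e: "e \<in> elements G"
  shows "mass_S_apply G e (\<lambda>_ _. 0\<^sub>v (ndof G e)) i j = 0\<^sub>v (ndof G e)"
proof -
  let ?N = "ndof G e"
  have c: "(case x of (k, l) \<Rightarrow> mass_S G e i j k l *\<^sub>v 0\<^sub>v ?N) = 0\<^sub>v ?N" for x
    by (cases x) (simp add: mult_mat_vec_zero_right[OF mass_S(1)[OF e]])
  have "vsum ?N (\<lambda>x. 0\<^sub>v ?N) (UNIV :: (3 \<times> 3) set) \<in> carrier_vec ?N"
    by (intro vsum_carrier) auto
  thus ?thesis
    unfolding mass_S_apply_def c by (intro eq_vecI) (auto simp: vsum_index)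
qed

lemma dg_solutionD:
  assumes "dg_solution G I v \<sigma>" "e \<in> elements G"
  shows "differentiable_vec I (ndof G e) (\<lambda>t. v t e i)"
    and "differentiable_vec I (ndof G e) (\<lambda>t. \<sigma> t e i j)"
    and "t \<in> I \<Longrightarrow> v t e i \<in> carrier_vec (ndof G e)"
    and "t \<in> I \<Longrightarrow> \<sigma> t e i j \<in> carrier_vec (ndof G e)"
    and "t \<in> I \<Longrightarrow> sym_coll (ndof G e) (\<sigma> t e)"
    and "t \<in> I \<Longrightarrow> mass_rho G e *\<^sub>v ddt I (ndof G e) (\<lambda>s. v s e i) t = velocity_rhs G (v t) (\<sigma> t) e i"
    and "t \<in> I \<Longrightarrow> sym_coll (ndof G e) \<psi> \<Longrightarrow>
       (\<Sum>i\<in>UNIV. \<Sum>j\<in>UNIV. \<psi> i j \<bullet> mass_S_apply G e (\<lambda>k l. ddt I (ndof G e) (\<lambda>s. \<sigma> s e k l) t) i j) =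
       (\<Sum>i\<in>UNIV. \<Sum>j\<in>UNIV. \<psi> i j \<bullet> stress_rhs G (v t) (\<sigma> t) e i j)"
  using assms unfolding dg_solution_def differentiable_vec_def by blast+

section \<open>The scheme on constant states\<close>

context
  fixes \<beta> :: "3 \<Rightarrow> real" and \<alpha> :: "3 \<Rightarrow> 3 \<Rightarrow> real" and v :: "'e velocity" and \<sigma> :: "'e stress"
  assumes sym: "\<And>i j. \<alpha> i j = \<alpha> j i"
    and const: "constant_state G \<beta> \<alpha> v \<sigma>"
begin

lemma constant_dofs:
  "e \<in> elements G \<Longrightarrow> v e i = \<beta> i \<cdot>\<^sub>v one_elem G e"
  "e \<in> elements G \<Longrightarrow> \<sigma> e i j = \<alpha> i j \<cdot>\<^sub>v one_elem G e"
  using const by (auto simp: constant_state_def)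

lemma constant_v_states:
  assumes m: "m \<in> mortars G"
  shows "v_plus G v m i = \<beta> i \<cdot>\<^sub>v one_mortar G m" "v_minus G v m i = \<beta> i \<cdot>\<^sub>v one_mortar G m"
proof -
  have "vsum (nquad G m) (\<lambda>e. projection G m e *\<^sub>v v e i) X =
      \<beta> i \<cdot>\<^sub>v vsum (nquad G m) (\<lambda>e. projection G m e *\<^sub>v one_elem G e) X"
    if X: "X \<subseteq> elements_of G m" "finite X" for X
  proof -
    have "vsum (nquad G m) (\<lambda>e. projection G m e *\<^sub>v v e i) X =
        vsum (nquad G m) (\<lambda>e. \<beta> i \<cdot>\<^sub>v (projection G m e *\<^sub>v one_elem G e)) X"
    proof (rule vsum_cong[OF X(2)])
      fix e assume "e \<in> X"
      hence e: "e \<in> elements_of G m" "e \<in> elements G" using X elements_ofD by auto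
      show "projection G m e *\<^sub>v v e i = \<beta> i \<cdot>\<^sub>v (projection G m e *\<^sub>v one_elem G e)"
        using mult_mat_vec[OF projection_carrier(1)[OF m e(1)] one_elem_carrier[OF e(2)]]
        by (simp add: constant_dofs e)
      show "\<beta> i \<cdot>\<^sub>v (projection G m e *\<^sub>v one_elem G e) \<in> carrier_vec (nquad G m)"
        using projection_carrier(1)[OF m e(1)] one_elem_carrier[OF e(2)] by auto
    qed
    also have "\<dots> = \<beta> i \<cdot>\<^sub>v vsum (nquad G m) (\<lambda>e. projection G m e *\<^sub>v one_elem G e) X"
    proof (rule vsum_smult[OF X(2)])
      fix e assume "e \<in> X"
      hence e: "e \<in> elements_of G m" "e \<in> elements G" using X elements_ofD by auto
      show "projection G m e *\<^sub>v one_elem G e \<in> carrier_vec (nquad G m)"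
        using projection_carrier(1)[OF m e(1)] one_elem_carrier[OF e(2)] by auto
    qed
    finally show ?thesis .
  qed
  thus "v_plus G v m i = \<beta> i \<cdot>\<^sub>v one_mortar G m" "v_minus G v m i = \<beta> i \<cdot>\<^sub>v one_mortar G m"
    using sides[OF m] projection m
    by (auto simp: v_plus_def v_minus_def v_mortar_def projection_consistent_def)
qed

lemma constant_T_states:
  assumes m: "m \<in> mortars G"
  shows "T_plus G \<sigma> m i = vsum (nquad G m) (\<lambda>j. \<alpha> i j \<cdot>\<^sub>v normal G m j) UNIV"
    and "T_minus G \<sigma> m i = T_plus G \<sigma> m i"
proof -
  have "(\<forall>i j. \<alpha> i j = \<alpha> j i) \<and> (\<forall>e\<in>elements_of G m. \<forall>i j. \<sigma> e i j = \<alpha> i j \<cdot>\<^sub>v one_elem G e)"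
    using sym elements_ofD constant_dofs(2) by blast
  hence "\<forall>i. T_minus G \<sigma> m i = T_plus G \<sigma> m i \<and>
      T_plus G \<sigma> m i = vsum (nquad G m) (\<lambda>j. \<alpha> i j \<cdot>\<^sub>v normal G m j) UNIV"
    using traction m unfolding constant_traction_consistent_def by blast
  thus "T_plus G \<sigma> m i = vsum (nquad G m) (\<lambda>j. \<alpha> i j \<cdot>\<^sub>v normal G m j) UNIV"
    and "T_minus G \<sigma> m i = T_plus G \<sigma> m i" by auto
qed

text \<open>
  The states on the two sides agree, so the consistency of the flux applies at every quadrature node.
\<close>

lemma constant_stars:
  assumes m: "m \<in> mortars G"
  shows "T_star G v \<sigma> m i = T_plus G \<sigma> m i" "v_star G v \<sigma> m i = \<beta> i \<cdot>\<^sub>v one_mortar G m"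
proof -
  have flux: "flux_at G v \<sigma> m n =
      (vec_lambda (\<lambda>i. T_plus G \<sigma> m i $ n), vec_lambda (\<lambda>i. v_plus G v m i $ n))"
    if "n < nquad G m" for n
    using consistent_flux m that constant_v_states[OF m] constant_T_states(2)[OF m]
    unfolding flux_at_def flux_consistent_def by simp
  have "T_plus G \<sigma> m i \<in> carrier_vec (nquad G m)"
    using constant_T_states(1)[OF m] normal_carrier by (auto intro!: vsum_carrier)
  thus "T_star G v \<sigma> m i = T_plus G \<sigma> m i"
    by (intro eq_vecI) (auto simp: T_star_def flux)
  show "v_star G v \<sigma> m i = \<beta> i \<cdot>\<^sub>v one_mortar G m"
    by (intro eq_vecI) (auto simp: v_star_def flux constant_v_states[OF m] one_mortar_def)
qed

text \<open>
  The orientation signs of \<open>T_star_e\<close> and \<open>normal_e\<close> are the same, so the numerical traction seen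
  from \<open>e\<close> is the constant stress contracted with the normal outward to \<open>e\<close>.
\<close>

lemma constant_T_star_e:
  assumes m: "m \<in> mortars G"
  shows "T_star_e G v \<sigma> m e i = vsum (nquad G m) (\<lambda>j. \<alpha> i j \<cdot>\<^sub>v normal_e G m e j) UNIV"
proof -
  have c: "vsum (nquad G m) (\<lambda>j. \<alpha> i j \<cdot>\<^sub>v normal_e G m e j) UNIV \<in> carrier_vec (nquad G m)"
    "vsum (nquad G m) (\<lambda>j. \<alpha> i j \<cdot>\<^sub>v normal G m j) UNIV \<in> carrier_vec (nquad G m)"
    using normal_carrier by (auto intro!: vsum_carrier)
  show ?thesis
  proof (cases "e \<in> minus_side G m")
    case True
    thus ?thesis by (simp add: T_star_e_def constant_stars[OF m] constant_T_states[OF m] normal_e_def)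
  next
    case False
    have "- vsum (nquad G m) (\<lambda>j. \<alpha> i j \<cdot>\<^sub>v normal G m j) UNIV =
        vsum (nquad G m) (\<lambda>j. \<alpha> i j \<cdot>\<^sub>v - normal G m j) UNIV"
      using c normal_carrier False
      by (intro eq_vecI) (auto simp: vsum_index normal_e_def sum_negf[symmetric] normal_def)
    thus ?thesis
      using False by (simp add: T_star_e_def constant_stars[OF m] constant_T_states[OF m] normal_e_def)
  qed
qed

text \<open>
  Both terms equal \<open>\<Sum>\<^sub>j \<alpha>\<^sub>i\<^sub>j S\<^sub>j\<^sup>T 1\<close> up to sign: the volume term directly, the mortar term after
  exchanging the sums over \<open>j\<close> and over the mortars and applying the discrete divergence theorem for
  each \<open>j\<close>.
\<close>

lemma velocity_rhs_constant:
  assumes e: "e \<in> elements G"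
  shows "velocity_rhs G v \<sigma> e i = 0\<^sub>v (ndof G e)"
proof -
  let ?N = "ndof G e"
  let ?B = "\<lambda>m. transpose_mat (projection G m e) * W G m"
  note mD = mortars_ofD[OF e] and S = stiff_carrier[OF e] and one = one_elem_carrier[OF e]
  have P: "transpose_mat (projection G m e) \<in> carrier_mat ?N (nquad G m)" if "m \<in> mortars_of G e" for m
    using projection_carrier(1)[OF mD[OF that]] by simp
  have B: "?B m \<in> carrier_mat ?N (nquad G m)" if "m \<in> mortars_of G e" for m
    using P[OF that] W_carrier by auto
  have PW: "transpose_mat (projection G m e) *\<^sub>v (W G m *\<^sub>v x) = ?B m *\<^sub>v x"
    if "m \<in> mortars_of G e" "x \<in> carrier_vec (nquad G m)" for m x
    using assoc_mult_mat_vec[OF P[OF that(1)] W_carrier that(2)] by simp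
  have ne: "normal_e G m e j \<in> carrier_vec (nquad G m)" for m j by (rule normal_carrier)
  have Tc: "T_star_e G v \<sigma> m e i \<in> carrier_vec (nquad G m)" if "m \<in> mortars_of G e" for m
    using that by (subst constant_T_star_e) (auto intro!: vsum_carrier ne mD)
  have c1: "transpose_mat (stiff G e j) *\<^sub>v \<sigma> e i j \<in> carrier_vec ?N" for j
    using S[of j] one by (auto simp: constant_dofs e intro!: mult_mat_vec_carrier[of _ _ ?N])
  have c2: "?B m *\<^sub>v x \<in> carrier_vec ?N" if "m \<in> mortars_of G e" "x \<in> carrier_vec (nquad G m)" for m x
    using B[OF that(1)] that(2) by auto
  have "vsum ?N (\<lambda>j. transpose_mat (stiff G e j) *\<^sub>v \<sigma> e i j) UNIV $ a =
      vsum ?N (\<lambda>m. transpose_mat (projection G m e) *\<^sub>v (W G m *\<^sub>v T_star_e G v \<sigma> m e i))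
        (mortars_of G e) $ a" if a: "a < ?N" for a
  proof -
    have "vsum ?N (\<lambda>j. transpose_mat (stiff G e j) *\<^sub>v \<sigma> e i j) UNIV $ a =
        (\<Sum>j\<in>UNIV. \<alpha> i j * (transpose_mat (stiff G e j) *\<^sub>v one_elem G e) $ a)"
    proof (subst vsum_index[OF _ c1 a], simp, rule sum.cong[OF refl])
      fix j
      have "transpose_mat (stiff G e j) *\<^sub>v \<sigma> e i j = \<alpha> i j \<cdot>\<^sub>v (transpose_mat (stiff G e j) *\<^sub>v one_elem G e)"
        using S[of j] one by (subst constant_dofs[OF e], subst mult_mat_vec[of _ ?N ?N]) auto
      thus "(transpose_mat (stiff G e j) *\<^sub>v \<sigma> e i j) $ a =
          \<alpha> i j * (transpose_mat (stiff G e j) *\<^sub>v one_elem G e) $ a"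
        using a S[of j] by simp
    qed
    also have "\<dots> = (\<Sum>j\<in>UNIV. \<alpha> i j * (\<Sum>m\<in>mortars_of G e. (?B m *\<^sub>v normal_e G m e j) $ a))"
    proof (intro sum.cong refl arg_cong2[where f = "(*)"])
      fix j
      have "transpose_mat (stiff G e j) *\<^sub>v one_elem G e =
          vsum ?N (\<lambda>m. transpose_mat (projection G m e) *\<^sub>v (W G m *\<^sub>v normal_e G m e j)) (mortars_of G e)"
        using divergence e by (simp add: discrete_divergence_def)
      also have "\<dots> = vsum ?N (\<lambda>m. ?B m *\<^sub>v normal_e G m e j) (mortars_of G e)"
        using e by (intro vsum_cong PW c2 ne) auto
      finally show "(transpose_mat (stiff G e j) *\<^sub>v one_elem G e) $ a =
          (\<Sum>m\<in>mortars_of G e. (?B m *\<^sub>v normal_e G m e j) $ a)"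
        using vsum_index[OF finite_mortars_of[OF e] c2[OF _ ne] a] by simp
    qed
    also have "\<dots> = (\<Sum>m\<in>mortars_of G e. \<Sum>j\<in>UNIV. \<alpha> i j * (?B m *\<^sub>v normal_e G m e j) $ a)"
      by (subst sum.swap) (simp add: sum_distrib_left)
    also have "\<dots> = (\<Sum>m\<in>mortars_of G e. (?B m *\<^sub>v T_star_e G v \<sigma> m e i) $ a)"
    proof (rule sum.cong[OF refl])
      fix m assume m: "m \<in> mortars_of G e"
      have "(?B m *\<^sub>v T_star_e G v \<sigma> m e i) $ a = (\<Sum>j\<in>UNIV. (?B m *\<^sub>v (\<alpha> i j \<cdot>\<^sub>v normal_e G m e j)) $ a)"
        unfolding constant_T_star_e[OF mD(1)[OF m]]
        by (rule mult_mat_vsum_index[OF B[OF m] _ _ a]) (auto simp: ne)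
      also have "\<dots> = (\<Sum>j\<in>UNIV. \<alpha> i j * (?B m *\<^sub>v normal_e G m e j) $ a)"
        by (intro sum.cong refl) (simp only: mult_mat_vec[OF B[OF m] ne] smult_vec_index[OF c2[OF m ne] a])
      finally show "(\<Sum>j\<in>UNIV. \<alpha> i j * (?B m *\<^sub>v normal_e G m e j) $ a) = (?B m *\<^sub>v T_star_e G v \<sigma> m e i) $ a" ..
    qed
    also have "\<dots> = vsum ?N (\<lambda>m. ?B m *\<^sub>v T_star_e G v \<sigma> m e i) (mortars_of G e) $ a"
      using vsum_index[OF finite_mortars_of[OF e] c2[OF _ Tc] a] by simp
    also have "vsum ?N (\<lambda>m. ?B m *\<^sub>v T_star_e G v \<sigma> m e i) (mortars_of G e) =
        vsum ?N (\<lambda>m. transpose_mat (projection G m e) *\<^sub>v (W G m *\<^sub>v T_star_e G v \<sigma> m e i)) (mortars_of G e)"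
      using e by (intro vsum_cong PW[symmetric] Tc) (auto simp: PW Tc c2)
    finally show ?thesis .
  qed
  moreover have "vsum ?N (\<lambda>j. transpose_mat (stiff G e j) *\<^sub>v \<sigma> e i j) UNIV \<in> carrier_vec ?N"
    by (intro vsum_carrier c1)
  moreover have "vsum ?N (\<lambda>m. transpose_mat (projection G m e) *\<^sub>v (W G m *\<^sub>v T_star_e G v \<sigma> m e i))
      (mortars_of G e) \<in> carrier_vec ?N"
    by (intro vsum_carrier) (auto simp: PW Tc c2)
  ultimately show ?thesis
    unfolding velocity_rhs_def by (intro eq_vecI) auto
qed

lemma stress_rhs_constant:
  assumes e: "e \<in> elements G"
  shows "stress_rhs G v \<sigma> e i j = 0\<^sub>v (ndof G e)"
proof -
  let ?N = "ndof G e"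
  have S: "stiff G e j *\<^sub>v v e i = 0\<^sub>v ?N" for i j
    using stiffness e mult_mat_vec[OF stiff_carrier[OF e] one_elem_carrier[OF e]]
    by (auto simp: constant_dofs stiffness_consistent_def)
  have "transpose_mat (projection_n G m e j) *\<^sub>v (W G m *\<^sub>v (v_star G v \<sigma> m i - v_side G v m e i)) = 0\<^sub>v ?N"
    if m: "m \<in> mortars_of G e" for m
  proof -
    note mm = mortars_ofD[OF e m]
    have "v_star G v \<sigma> m i - v_side G v m e i = 0\<^sub>v (nquad G m)"
      by (auto simp: constant_stars[OF mm(1)] v_side_def constant_v_states[OF mm(1)] one_mortar_def)
    thus ?thesis
      using projection_carrier(2)[OF mm, of j] W_carrier[of m]
      by (auto intro!: eq_vecI simp: scalar_prod_def)
  qed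
  hence "vsum ?N (\<lambda>m. transpose_mat (projection_n G m e j) *\<^sub>v
      (W G m *\<^sub>v (v_star G v \<sigma> m i - v_side G v m e i))) (mortars_of G e) = vsum ?N (\<lambda>m. 0\<^sub>v ?N) (mortars_of G e)"
    using e by (intro vsum_cong) auto
  also have "\<dots> = 0\<^sub>v ?N"
    using vsum_index[of "mortars_of G e" "\<lambda>_. 0\<^sub>v ?N" ?N] vsum_carrier[of "mortars_of G e" "\<lambda>_. 0\<^sub>v ?N" ?N] e
    by (intro eq_vecI) auto
  finally show ?thesis
    by (auto simp: stress_rhs_def S)
qed

end

text \<open>
  The stress equation is only tested against symmetric collections.  The derivative \<open>\<tau>\<close> of the stress is
  itself symmetric, and testing with it shows that the definite form vanishes at \<open>\<tau>\<close>, so \<open>\<tau> = 0\<close>;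
  the componentwise identity for the mass matrices follows from this.
\<close>

lemma constant_derivatives_zero:
  assumes sym: "\<And>i j. \<alpha> i j = \<alpha> j i"
    and sol: "dg_solution G I v \<sigma>" and t: "t \<in> I"
    and const: "constant_state G \<beta> \<alpha> (v t) (\<sigma> t)"
    and e: "e \<in> elements G"
  shows "mass_rho G e *\<^sub>v ddt I (ndof G e) (\<lambda>s. v s e i) t = 0\<^sub>v (ndof G e)"
    and "mass_S_apply G e (\<lambda>k l. ddt I (ndof G e) (\<lambda>s. \<sigma> s e k l) t) i j = 0\<^sub>v (ndof G e)"
    and "ddt I (ndof G e) (\<lambda>s. v s e i) t = 0\<^sub>v (ndof G e)"
    and "ddt I (ndof G e) (\<lambda>s. \<sigma> s e i j) t = 0\<^sub>v (ndof G e)"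
proof -
  let ?N = "ndof G e"
  let ?dv = "ddt I ?N (\<lambda>s. v s e i) t"
  define \<tau> where "\<tau> = (\<lambda>k l. ddt I ?N (\<lambda>s. \<sigma> s e k l) t)"
  note D = dg_solutionD[OF sol e]
  show Mv: "mass_rho G e *\<^sub>v ?dv = 0\<^sub>v ?N"
    using D(6)[OF t] velocity_rhs_constant[OF sym const e] by simp
  hence "?dv \<bullet> (mass_rho G e *\<^sub>v ?dv) = 0"
    by (simp add: scalar_prod_def)
  thus "?dv = 0\<^sub>v ?N"
    using mass_rho(3)[OF e, of ?dv] by force
  have "\<tau> k l = \<tau> l k" for k l
    unfolding \<tau>_def using D(5) t by (intro ddt_cong) (auto simp: sym_coll_def)
  hence \<tau>: "sym_coll ?N \<tau>" by (simp add: sym_coll_def \<tau>_def)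
  have "(\<Sum>i\<in>UNIV. \<Sum>j\<in>UNIV. \<tau> i j \<bullet> mass_S_apply G e \<tau> i j) = 0"
    using D(7)[OF t \<tau>] unfolding \<tau>_def stress_rhs_constant[OF sym const e] by (simp add: scalar_prod_def)
  hence "S_form e \<tau> = 0"
    unfolding S_form_def using \<tau> by (simp add: scalar_prod_mass_S_apply[OF e] sym_coll_def)
  hence zero: "\<tau> k l = 0\<^sub>v ?N" for k l
    using mass_S_pos[OF e \<tau>] unfolding S_form_def by force
  thus "ddt I ?N (\<lambda>s. \<sigma> s e i j) t = 0\<^sub>v ?N"
    by (simp add: \<tau>_def)
  have "\<tau> = (\<lambda>_ _. 0\<^sub>v ?N)" using zero by blast
  thus "mass_S_apply G e (\<lambda>k l. ddt I ?N (\<lambda>s. \<sigma> s e k l) t) i j = 0\<^sub>v ?N"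
    using mass_S_apply_zero[OF e] unfolding \<tau>_def by simp
qed

lemma constant_solution:
  assumes sym: "\<And>i j. \<alpha> i j = \<alpha> j i" and I: "time_interval I"
  shows "dg_solution G I (\<lambda>t e i. \<beta> i \<cdot>\<^sub>v one_elem G e) (\<lambda>t e i j. \<alpha> i j \<cdot>\<^sub>v one_elem G e)"
proof -
  have const: "constant_state G \<beta> \<alpha> (\<lambda>e i. \<beta> i \<cdot>\<^sub>v one_elem G e) (\<lambda>e i j. \<alpha> i j \<cdot>\<^sub>v one_elem G e)"
    by (simp add: constant_state_def)
  have "differentiable_vec I (ndof G e) (\<lambda>_. r \<cdot>\<^sub>v one_elem G e)" if "e \<in> elements G" for e r
    using one_elem_carrier[OF that] by (simp add: differentiable_vec_def)
  thus ?thesis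
    unfolding dg_solution_def
    using sym one_elem_carrier mass_S_apply_zero mult_mat_vec_zero_right[OF mass_rho(1)]
    by (auto simp: ddt_const[OF I] sym_coll_def velocity_rhs_constant[OF sym const]
        stress_rhs_constant[OF sym const])
qed

section \<open>Right-hand sides near a given state\<close>

lemma near_v_plus_minus:
  assumes m: "m \<in> mortars G"
    and v: "\<And>e i. e \<in> elements G \<Longrightarrow> near F g (ndof G e) (\<lambda>t. v t e i) (v0 e i)"
  shows "near F g (nquad G m) (\<lambda>t. v_plus G (v t) m i) (v_plus G v0 m i)"
    and "near F g (nquad G m) (\<lambda>t. v_minus G (v t) m i) (v_minus G v0 m i)"
  unfolding v_plus_def v_minus_def v_mortar_def
  using sides[OF m] elements_ofD
  by (auto intro!: near_vsum near_mult_mat projection_carrier m v)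

lemma near_T_plus_minus:
  assumes m: "m \<in> mortars G"
    and \<sigma>: "\<And>e i j. e \<in> elements G \<Longrightarrow> near F g (ndof G e) (\<lambda>t. \<sigma> t e i j) (\<sigma>0 e i j)"
  shows "near F g (nquad G m) (\<lambda>t. T_plus G (\<sigma> t) m i) (T_plus G \<sigma>0 m i)"
    and "near F g (nquad G m) (\<lambda>t. T_minus G (\<sigma> t) m i) (T_minus G \<sigma>0 m i)"
  unfolding T_plus_def T_minus_def T_mortar_def
  using sides[OF m] elements_ofD
  by (auto intro!: near_uminus near_vsum near_mult_mat projection_carrier m \<sigma>)

text \<open>
  The only nonlinear step.  As \<open>g\<close> tends to zero, the arguments of the flux at each node enter the ball
  on which it is Lipschitz, and there the rate \<open>g\<close> passes from the arguments to the values.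
\<close>

lemma near_flux:
  assumes m: "m \<in> mortars G" and lip: "flux_locally_lipschitz G" and g: "(g \<longlongrightarrow> 0) F"
    and v: "\<And>e i. e \<in> elements G \<Longrightarrow> near F g (ndof G e) (\<lambda>t. v t e i) (v0 e i)"
    and \<sigma>: "\<And>e i j. e \<in> elements G \<Longrightarrow> near F g (ndof G e) (\<lambda>t. \<sigma> t e i j) (\<sigma>0 e i j)"
  shows "near F g (nquad G m) (\<lambda>t. T_star G (v t) (\<sigma> t) m i) (T_star G v0 \<sigma>0 m i)"
    and "near F g (nquad G m) (\<lambda>t. v_star G (v t) (\<sigma> t) m i) (v_star G v0 \<sigma>0 m i)"
proof -
  have flux: "(\<lambda>t. norm (flux_at G (v t) (\<sigma> t) m n - flux_at G v0 \<sigma>0 m n)) \<in> O[F](g)"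
    if n: "n < nquad G m" for n
  proof -
    define st where "st = (\<lambda>v \<sigma>. (vec_lambda (\<lambda>i. v_plus G v m i $ n), vec_lambda (\<lambda>i. v_minus G v m i $ n),
      vec_lambda (\<lambda>i. T_plus G \<sigma> m i $ n), vec_lambda (\<lambda>i. T_minus G \<sigma> m i $ n)) :: (real^3) \<times> (real^3) \<times> (real^3) \<times> (real^3))"
    have flux_at: "flux_at G v \<sigma> m n = flux G m n (st v \<sigma>)" for v \<sigma>
      by (simp add: flux_at_def st_def)
    \<comment> \<open>\<open>b\<close> dominates the distance of the flux arguments and is a finite sum of \<open>O(g)\<close> terms\<close>
    define b where "b = (\<lambda>t. (\<Sum>i\<in>UNIV. \<bar>v_plus G (v t) m i $ n - v_plus G v0 m i $ n\<bar>)
      + ((\<Sum>i\<in>UNIV. \<bar>v_minus G (v t) m i $ n - v_minus G v0 m i $ n\<bar>)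
      + ((\<Sum>i\<in>UNIV. \<bar>T_plus G (\<sigma> t) m i $ n - T_plus G \<sigma>0 m i $ n\<bar>)
      + (\<Sum>i\<in>UNIV. \<bar>T_minus G (\<sigma> t) m i $ n - T_minus G \<sigma>0 m i $ n\<bar>))))"
    have "b \<in> O[F](g)"
      unfolding b_def using near_v_plus_minus[OF m v] near_T_plus_minus[OF m \<sigma>] n
      by (intro sum_in_bigo(1) big_sum_in_bigo) (auto simp: near_def)
    have st_b: "norm (st (v t) (\<sigma> t) - st v0 \<sigma>0) \<le> b t" for t
    proof -
      have l1: "norm (vec_lambda (\<lambda>i. x i) - vec_lambda (\<lambda>i. y i) :: real^3) \<le> (\<Sum>i\<in>UNIV. \<bar>x i - y i\<bar>)" for x y
        using norm_le_l1_cart[of "vec_lambda (\<lambda>i. x i) - vec_lambda (\<lambda>i. y i) :: real^3"] by simp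
      show ?thesis
        unfolding st_def b_def
        by (auto intro!: order_trans[OF norm_Pair_le] add_mono l1)
    qed
    have "(b \<longlongrightarrow> 0) F"
      using landau_o.big_small_trans[OF \<open>b \<in> O[F](g)\<close>, of "\<lambda>_. 1"] g
      by (auto simp: smalloI_tendsto dest: smalloD_tendsto)
    obtain u L where u: "u > 0" and L: "L-lipschitz_on (cball (st v0 \<sigma>0) u) (flux G m n)"
      using lip m n unfolding flux_locally_lipschitz_def by metis
    have "\<forall>\<^sub>F t in F. norm (norm (flux_at G (v t) (\<sigma> t) m n - flux_at G v0 \<sigma>0 m n)) \<le> L * norm (b t)"
      using order_tendstoD(2)[OF \<open>(b \<longlongrightarrow> 0) F\<close> u]
    proof eventually_elim
      case (elim t)
      have "dist (flux G m n (st (v t) (\<sigma> t))) (flux G m n (st v0 \<sigma>0)) \<le> L * dist (st (v t) (\<sigma> t)) (st v0 \<sigma>0)"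
        using st_b[of t] elim u by (intro lipschitz_onD[OF L]) (auto simp: dist_norm norm_minus_commute)
      also have "\<dots> \<le> L * b t"
        using st_b[of t] lipschitz_on_nonneg[OF L] by (intro mult_left_mono) (auto simp: dist_norm)
      also have "\<dots> \<le> L * norm (b t)"
        using lipschitz_on_nonneg[OF L] by (intro mult_left_mono) auto
      finally show ?case by (simp add: flux_at dist_norm)
    qed
    hence "(\<lambda>t. norm (flux_at G (v t) (\<sigma> t) m n - flux_at G v0 \<sigma>0 m n)) \<in> O[F](b)"
      by (rule bigoI)
    thus ?thesis using \<open>b \<in> O[F](g)\<close> by (rule landau_o.big_trans)
  qed
  have comp: "\<bar>vec_nth (fst p) i - vec_nth (fst q) i\<bar> \<le> norm (p - q)"
    "\<bar>vec_nth (snd p) i - vec_nth (snd q) i\<bar> \<le> norm (p - q)" for p q :: "(real^3) \<times> (real^3)"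
  proof -
    have "norm (fst (p - q)) \<le> norm (p - q)" "norm (snd (p - q)) \<le> norm (p - q)"
      by (metis norm_fst_le prod.collapse) (metis norm_snd_le prod.collapse)
    thus "\<bar>vec_nth (fst p) i - vec_nth (fst q) i\<bar> \<le> norm (p - q)"
      "\<bar>vec_nth (snd p) i - vec_nth (snd q) i\<bar> \<le> norm (p - q)"
      using component_le_norm_cart[of "fst (p - q)" i] component_le_norm_cart[of "snd (p - q)" i] by auto
  qed
  show "near F g (nquad G m) (\<lambda>t. T_star G (v t) (\<sigma> t) m i) (T_star G v0 \<sigma>0 m i)"
    unfolding T_star_def
    by (intro near_vec landau_o.big_trans[OF bigoI[of _ 1] flux]) (auto simp: comp)
  show "near F g (nquad G m) (\<lambda>t. v_star G (v t) (\<sigma> t) m i) (v_star G v0 \<sigma>0 m i)"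
    unfolding v_star_def
    by (intro near_vec landau_o.big_trans[OF bigoI[of _ 1] flux]) (auto simp: comp)
qed

lemma near_rhs:
  assumes lip: "flux_locally_lipschitz G" and g: "(g \<longlongrightarrow> 0) F"
    and v: "\<And>e i. e \<in> elements G \<Longrightarrow> near F g (ndof G e) (\<lambda>t. v t e i) (v0 e i)"
    and \<sigma>: "\<And>e i j. e \<in> elements G \<Longrightarrow> near F g (ndof G e) (\<lambda>t. \<sigma> t e i j) (\<sigma>0 e i j)"
    and e: "e \<in> elements G"
  shows "near F g (ndof G e) (\<lambda>t. velocity_rhs G (v t) (\<sigma> t) e i) (velocity_rhs G v0 \<sigma>0 e i)"
    and "near F g (ndof G e) (\<lambda>t. stress_rhs G (v t) (\<sigma> t) e i j) (stress_rhs G v0 \<sigma>0 e i j)"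
proof -
  have T: "near F g (nquad G m) (\<lambda>t. T_star_e G (v t) (\<sigma> t) m e i) (T_star_e G v0 \<sigma>0 m e i)"
    if "m \<in> mortars_of G e" for m
    using near_flux(1)[OF mortars_ofD(1)[OF e that] lip g v \<sigma>] by (auto simp: T_star_e_def intro: near_uminus)
  have V: "near F g (nquad G m) (\<lambda>t. v_side G (v t) m e i) (v_side G v0 m e i)"
    if "m \<in> mortars_of G e" for m
    using near_v_plus_minus[OF mortars_ofD(1)[OF e that] v] by (auto simp: v_side_def)
  note tr = transpose_carrier_mat[THEN iffD2]
  show "near F g (ndof G e) (\<lambda>t. velocity_rhs G (v t) (\<sigma> t) e i) (velocity_rhs G v0 \<sigma>0 e i)"
    unfolding velocity_rhs_def using e
    by (intro near_add near_uminus near_vsum)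
       (auto intro!: near_mult_mat tr W_carrier T \<sigma> stiff_carrier projection_carrier dest: mortars_ofD)
  show "near F g (ndof G e) (\<lambda>t. stress_rhs G (v t) (\<sigma> t) e i j) (stress_rhs G v0 \<sigma>0 e i j)"
    unfolding stress_rhs_def using e
    by (intro near_add near_smult near_vsum)
       (auto intro!: near_mult_mat near_diff tr W_carrier V v near_flux[OF _ lip g v \<sigma>]
          stiff_carrier projection_carrier dest: mortars_ofD)
qed

section \<open>The energy of a deviation\<close>

lemma mass_rho_coercive:
  assumes e: "e \<in> elements G"
  obtains c where "c > 0"
    "\<And>p. p \<in> carrier_vec (ndof G e) \<Longrightarrow> c * (\<Sum>a<ndof G e. (p $ a)\<^sup>2) \<le> p \<bullet> (mass_rho G e *\<^sub>v p)"
proof -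
  let ?N = "ndof G e" and ?M = "mass_rho G e"
  note M = mass_rho[OF e]
  define V where "V = {x :: nat \<Rightarrow> real. \<forall>a\<in>-{..<?N}. x a = 0}"
  define q where "q = (\<lambda>x. Matrix.vec ?N x \<bullet> (?M *\<^sub>v Matrix.vec ?N x))"
  obtain c where c: "c > 0" "\<And>x. x \<in> V \<Longrightarrow> c * (\<Sum>a<?N. (x a)\<^sup>2) \<le> q x"
  proof (rule quadratic_coercive[of "{..<?N}" q V])
    show "continuous_on UNIV q"
      unfolding q_def by (intro continuous_on_bilinear_form M(1) continuous_on_product_coordinates)
    show "q (\<lambda>a. r * x a) = r\<^sup>2 * q x" for r x
      unfolding q_def by (rule bilinear_form_scale[OF M(1)])
    have "V = (\<Inter>a\<in>-{..<?N}. {x. x a = 0})" by (auto simp: V_def)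
    also have "closed \<dots>"
      by (intro closed_INT ballI closed_Collect_eq continuous_on_product_coordinates continuous_on_const)
    finally show "closed V" .
    show "q x > 0" if x: "x \<in> V" "x \<noteq> (\<lambda>_. 0)" for x
      unfolding q_def
    proof (rule M(3))
      obtain a where a: "x a \<noteq> 0" using x(2) by auto
      hence "a < ?N" using x(1) by (auto simp: V_def)
      thus "Matrix.vec ?N x \<noteq> 0\<^sub>v ?N" using a by (metis index_vec index_zero_vec(1))
    qed simp
  qed (auto simp: V_def)
  show ?thesis
  proof (rule that[OF c(1)])
    fix p :: "real vec" assume p: "p \<in> carrier_vec ?N"
    define x where "x = (\<lambda>a. if a < ?N then p $ a else 0)"
    have "Matrix.vec ?N x = p" using p by (auto simp: x_def)
    moreover have "(\<Sum>a<?N. (x a)\<^sup>2) = (\<Sum>a<?N. (p $ a)\<^sup>2)" by (simp add: x_def)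
    moreover have "x \<in> V" by (simp add: x_def V_def)
    ultimately show "c * (\<Sum>a<?N. (p $ a)\<^sup>2) \<le> p \<bullet> (?M *\<^sub>v p)"
      using c(2)[of x] by (simp add: q_def)
  qed
qed

text \<open>
  Definiteness is known only for symmetric collections, so the form is minimized over the closed
  subspace of arrays symmetric in the two stress indices.
\<close>

lemma mass_S_coercive:
  assumes e: "e \<in> elements G"
  obtains c where "c > 0"
    "\<And>s. sym_coll (ndof G e) s \<Longrightarrow> c * (\<Sum>i\<in>UNIV. \<Sum>j\<in>UNIV. \<Sum>a<ndof G e. (s i j $ a)\<^sup>2) \<le> S_form e s"
proof -
  let ?N = "ndof G e"
  define J :: "(3 \<times> 3 \<times> nat) set" where "J = UNIV \<times> UNIV \<times> {..<?N}"
  define V where "V = {x :: 3 \<times> 3 \<times> nat \<Rightarrow> real. (\<forall>i j a. x (i, j, a) = x (j, i, a)) \<and> (\<forall>p\<in>-J. x p = 0)}"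
  define st where "st = (\<lambda>x :: 3 \<times> 3 \<times> nat \<Rightarrow> real. \<lambda>i j. Matrix.vec ?N (\<lambda>a. x (i, j, a)))"
  obtain c where c: "c > 0" "\<And>x. x \<in> V \<Longrightarrow> c * (\<Sum>p\<in>J. (x p)\<^sup>2) \<le> S_form e (st x)"
  proof (rule quadratic_coercive[of J "\<lambda>x. S_form e (st x)" V])
    show "finite J" by (simp add: J_def)
    show "continuous_on UNIV (\<lambda>x. S_form e (st x))"
      unfolding S_form_def st_def
      by (intro continuous_on_sum continuous_on_bilinear_form mass_S[OF e] continuous_on_product_coordinates)
    show "S_form e (st (\<lambda>p. r * x p)) = r\<^sup>2 * S_form e (st x)" for r x
      unfolding S_form_def st_def
      by (simp add: bilinear_form_scale[OF mass_S(1)[OF e]] sum_distrib_left)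
    have "V = (\<Inter>i. \<Inter>j. \<Inter>a. {x. x (i, j, a) = x (j, i, a)}) \<inter> (\<Inter>p\<in>-J. {x. x p = 0})"
      by (auto simp: V_def)
    also have "closed \<dots>"
      by (intro closed_Int closed_INT ballI closed_Collect_eq continuous_on_product_coordinates continuous_on_const)
    finally show "closed V" .
    show "S_form e (st x) > 0" if x: "x \<in> V" "x \<noteq> (\<lambda>_. 0)" for x
      unfolding S_form_def
    proof (rule mass_S_pos[OF e])
      show "sym_coll ?N (st x)"
        using x(1) by (auto simp: sym_coll_def st_def V_def)
      obtain i j a where a: "x (i, j, a) \<noteq> 0" using x(2) by (metis ext prod_cases3)
      hence "(i, j, a) \<in> J" using x(1) unfolding V_def by blast
      hence "a < ?N" by (simp add: J_def)
      hence "st x i j $ a \<noteq> 0\<^sub>v ?N $ a" using a by (simp add: st_def)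
      thus "\<exists>i j. st x i j \<noteq> 0\<^sub>v ?N" by metis
    qed
    show "(\<lambda>a. r * x a) \<in> V" if "x \<in> V" for r x
      using that by (auto simp: V_def)
    show "x p = 0" if "x \<in> V" "p \<notin> J" for x p
      using that by (auto simp: V_def)
  qed blast
  show ?thesis
  proof (rule that[OF c(1)])
    fix s :: "3 \<Rightarrow> 3 \<Rightarrow> real vec" assume s: "sym_coll ?N s"
    define x where "x = (\<lambda>(i, j, a). if a < ?N then s i j $ a else 0)"
    have dim: "dim_vec (s i j) = ?N" for i j
      using s by (meson carrier_vecD sym_coll_def)
    hence "st x = s"
      by (intro ext eq_vecI) (simp_all add: x_def st_def dim)
    moreover have "(\<Sum>p\<in>J. (x p)\<^sup>2) = (\<Sum>i\<in>UNIV. \<Sum>j\<in>UNIV. \<Sum>a<?N. (s i j $ a)\<^sup>2)"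
      unfolding J_def x_def sum.cartesian_product' by simp
    moreover have "x \<in> V" using s by (auto simp: x_def V_def J_def sym_coll_def)
    ultimately show "c * (\<Sum>i\<in>UNIV. \<Sum>j\<in>UNIV. \<Sum>a<?N. (s i j $ a)\<^sup>2) \<le> S_form e s"
      using c(2)[of x] by simp
  qed
qed

text \<open>
  The symmetry of each mass matrix and of the compliance tensor under exchange of index pairs makes the
  two halves of the product rule equal.
\<close>

lemma S_form_has_derivative:
  assumes e: "e \<in> elements G"
    and s: "\<And>t i j. t \<in> I \<Longrightarrow> s t i j \<in> carrier_vec (ndof G e)" and s': "\<And>i j. s' i j \<in> carrier_vec (ndof G e)"
    and der: "\<And>i j a. a < ndof G e \<Longrightarrow> ((\<lambda>t. s t i j $ a) has_real_derivative s' i j $ a) (at t within I)"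
    and t: "t \<in> I"
  shows "((\<lambda>t. S_form e (s t)) has_real_derivative
    2 * (\<Sum>i\<in>UNIV. \<Sum>j\<in>UNIV. s t i j \<bullet> mass_S_apply G e s' i j)) (at t within I)"
proof -
  let ?f = "\<lambda>i j k l. s t i j \<bullet> (mass_S G e i j k l *\<^sub>v s' k l)"
  have swap: "s' i j \<bullet> (mass_S G e i j k l *\<^sub>v s t k l) = ?f k l i j" for i j k l
    using bilinear_form_symmetric[OF mass_S(1,2)[OF e] s'[of i j] s[OF t, of k l], of i j k l] mass_S(3)[OF e, of i j k l]
    by simp
  have "((\<lambda>t. S_form e (s t)) has_real_derivative
     (\<Sum>i\<in>UNIV. \<Sum>j\<in>UNIV. \<Sum>k\<in>UNIV. \<Sum>l\<in>UNIV.
        s' i j \<bullet> (mass_S G e i j k l *\<^sub>v s t k l) + ?f i j k l)) (at t within I)"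
    unfolding S_form_def by (intro DERIV_sum bilinear_form_has_derivative[OF mass_S(1)[OF e]] s s' der t)
  also have "(\<Sum>i\<in>UNIV. \<Sum>j\<in>UNIV. \<Sum>k\<in>UNIV. \<Sum>l\<in>UNIV.
        s' i j \<bullet> (mass_S G e i j k l *\<^sub>v s t k l) + ?f i j k l) =
      (\<Sum>p\<in>UNIV. \<Sum>r\<in>UNIV. ?f (fst r) (snd r) (fst p) (snd p) + ?f (fst p) (snd p) (fst r) (snd r))"
    unfolding UNIV_Times_UNIV[symmetric] sum.cartesian_product' by (simp add: swap)
  also have "\<dots> = 2 * (\<Sum>p\<in>UNIV. \<Sum>r\<in>UNIV. ?f (fst p) (snd p) (fst r) (snd r))"
    by (simp add: sum.distrib sum.swap[of "\<lambda>p r. ?f (fst r) (snd r) (fst p) (snd p)"])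
  also have "(\<Sum>p\<in>UNIV. \<Sum>r\<in>UNIV. ?f (fst p) (snd p) (fst r) (snd r)) =
      (\<Sum>i\<in>UNIV. \<Sum>j\<in>UNIV. s t i j \<bullet> mass_S_apply G e s' i j)"
    unfolding UNIV_Times_UNIV[symmetric] sum.cartesian_product' by (simp add: scalar_prod_mass_S_apply[OF e s'])
  finally show ?thesis .
qed

definition energy :: "'e \<Rightarrow> (3 \<Rightarrow> real vec) \<Rightarrow> (3 \<Rightarrow> 3 \<Rightarrow> real vec) \<Rightarrow> real" where
  "energy e p s = (\<Sum>i\<in>UNIV. p i \<bullet> (mass_rho G e *\<^sub>v p i)) + S_form e s"

lemma energy_coercive:
  assumes e: "e \<in> elements G"
  obtains c where "c > 0"
    "\<And>p s i a. (\<And>i. p i \<in> carrier_vec (ndof G e)) \<Longrightarrow> sym_coll (ndof G e) s \<Longrightarrow> a < ndof G e \<Longrightarrow>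
       c * (p i $ a)\<^sup>2 \<le> energy e p s"
    "\<And>p s i j a. (\<And>i. p i \<in> carrier_vec (ndof G e)) \<Longrightarrow> sym_coll (ndof G e) s \<Longrightarrow> a < ndof G e \<Longrightarrow>
       c * (s i j $ a)\<^sup>2 \<le> energy e p s"
    "\<And>p s. (\<And>i. p i \<in> carrier_vec (ndof G e)) \<Longrightarrow> sym_coll (ndof G e) s \<Longrightarrow> 0 \<le> energy e p s"
proof -
  let ?N = "ndof G e"
  obtain c1 where c1: "c1 > 0"
    "\<And>p. p \<in> carrier_vec ?N \<Longrightarrow> c1 * (\<Sum>a<?N. (p $ a)\<^sup>2) \<le> p \<bullet> (mass_rho G e *\<^sub>v p)"
    using mass_rho_coercive[OF e] by blast
  obtain c2 where c2: "c2 > 0"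
    "\<And>s. sym_coll ?N s \<Longrightarrow> c2 * (\<Sum>i\<in>UNIV. \<Sum>j\<in>UNIV. \<Sum>a<?N. (s i j $ a)\<^sup>2) \<le> S_form e s"
    using mass_S_coercive[OF e] by blast
  define c where "c = min c1 c2"
  have c: "c > 0" using c1 c2 by (simp add: c_def)
  have bound: "c * ((\<Sum>i\<in>UNIV. \<Sum>a<?N. (p i $ a)\<^sup>2) + (\<Sum>i\<in>UNIV. \<Sum>j\<in>UNIV. \<Sum>a<?N. (s i j $ a)\<^sup>2)) \<le> energy e p s"
    if p: "\<And>i. p i \<in> carrier_vec ?N" and s: "sym_coll ?N s" for p s
  proof -
    have "c * (\<Sum>i\<in>UNIV. \<Sum>a<?N. (p i $ a)\<^sup>2) \<le> c1 * (\<Sum>i\<in>UNIV. \<Sum>a<?N. (p i $ a)\<^sup>2)"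
      by (intro mult_right_mono sum_nonneg) (auto simp: c_def)
    also have "\<dots> \<le> (\<Sum>i\<in>UNIV. p i \<bullet> (mass_rho G e *\<^sub>v p i))"
      unfolding sum_distrib_left[of c1] using c1(2)[OF p] by (intro sum_mono) (simp add: sum_distrib_left)
    finally have 1: "c * (\<Sum>i\<in>UNIV. \<Sum>a<?N. (p i $ a)\<^sup>2) \<le> (\<Sum>i\<in>UNIV. p i \<bullet> (mass_rho G e *\<^sub>v p i))" .
    have "c * (\<Sum>i\<in>UNIV. \<Sum>j\<in>UNIV. \<Sum>a<?N. (s i j $ a)\<^sup>2) \<le> c2 * (\<Sum>i\<in>UNIV. \<Sum>j\<in>UNIV. \<Sum>a<?N. (s i j $ a)\<^sup>2)"
      by (intro mult_right_mono sum_nonneg) (auto simp: c_def)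
    also note c2(2)[OF s]
    finally show ?thesis using 1 by (simp add: energy_def distrib_left)
  qed
  have p_le: "(p i $ a)\<^sup>2 \<le> (\<Sum>i\<in>UNIV. \<Sum>a<?N. (p i $ a)\<^sup>2)" if "a < ?N" for p :: "3 \<Rightarrow> real vec" and i a
  proof -
    have "(p i $ a)\<^sup>2 \<le> (\<Sum>a<?N. (p i $ a)\<^sup>2)"
      using that by (intro member_le_sum[where f = "\<lambda>a. (p i $ a)\<^sup>2"]) auto
    also have "\<dots> \<le> (\<Sum>i\<in>UNIV. \<Sum>a<?N. (p i $ a)\<^sup>2)"
      by (intro member_le_sum[where f = "\<lambda>i. \<Sum>a<?N. (p i $ a)\<^sup>2"] sum_nonneg) auto
    finally show ?thesis .
  qed
  have s_le: "(s i j $ a)\<^sup>2 \<le> (\<Sum>i\<in>UNIV. \<Sum>j\<in>UNIV. \<Sum>a<?N. (s i j $ a)\<^sup>2)" if "a < ?N"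
    for s :: "3 \<Rightarrow> 3 \<Rightarrow> real vec" and i j a
  proof -
    have "(s i j $ a)\<^sup>2 \<le> (\<Sum>j\<in>UNIV. \<Sum>a<?N. (s i j $ a)\<^sup>2)"
      by (rule p_le[OF that])
    also have "\<dots> \<le> (\<Sum>i\<in>UNIV. \<Sum>j\<in>UNIV. \<Sum>a<?N. (s i j $ a)\<^sup>2)"
      by (intro member_le_sum[where f = "\<lambda>i. \<Sum>j\<in>UNIV. \<Sum>a<?N. (s i j $ a)\<^sup>2"] sum_nonneg) auto
    finally show ?thesis .
  qed
  have nn: "0 \<le> (\<Sum>i\<in>UNIV. \<Sum>a<?N. (p i $ a)\<^sup>2)" "0 \<le> (\<Sum>i\<in>UNIV. \<Sum>j\<in>UNIV. \<Sum>a<?N. (s i j $ a)\<^sup>2)"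
    for p :: "3 \<Rightarrow> real vec" and s :: "3 \<Rightarrow> 3 \<Rightarrow> real vec"
    by (intro sum_nonneg; simp)+
  show ?thesis
  proof (rule that[OF c])
    fix p :: "3 \<Rightarrow> real vec" and s :: "3 \<Rightarrow> 3 \<Rightarrow> real vec" and i j a
    assume ps: "\<And>i. p i \<in> carrier_vec ?N" "sym_coll ?N s"
    show "0 \<le> energy e p s"
      using c by (intro order_trans[OF _ bound[OF ps]] mult_nonneg_nonneg add_nonneg_nonneg nn) auto
    assume a: "a < ?N"
    show "c * (p i $ a)\<^sup>2 \<le> energy e p s"
      using c p_le[OF a, of p i] nn(2)[of s]
      by (intro order_trans[OF _ bound[OF ps]] mult_left_mono) auto
    show "c * (s i j $ a)\<^sup>2 \<le> energy e p s"
      using c s_le[OF a, of s i j] nn(1)[of p]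
      by (intro order_trans[OF _ bound[OF ps]] mult_left_mono) auto
  qed
qed

lemma energy_has_derivative:
  assumes e: "e \<in> elements G"
    and p: "\<And>t i. t \<in> I \<Longrightarrow> p t i \<in> carrier_vec (ndof G e)" and p': "\<And>i. p' i \<in> carrier_vec (ndof G e)"
    and s: "\<And>t i j. t \<in> I \<Longrightarrow> s t i j \<in> carrier_vec (ndof G e)" and s': "\<And>i j. s' i j \<in> carrier_vec (ndof G e)"
    and dp: "\<And>i a. a < ndof G e \<Longrightarrow> ((\<lambda>t. p t i $ a) has_real_derivative p' i $ a) (at t within I)"
    and ds: "\<And>i j a. a < ndof G e \<Longrightarrow> ((\<lambda>t. s t i j $ a) has_real_derivative s' i j $ a) (at t within I)"
    and t: "t \<in> I"
  shows "((\<lambda>t. energy e (p t) (s t)) has_real_derivative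
    2 * ((\<Sum>i\<in>UNIV. p t i \<bullet> (mass_rho G e *\<^sub>v p' i)) +
         (\<Sum>i\<in>UNIV. \<Sum>j\<in>UNIV. s t i j \<bullet> mass_S_apply G e s' i j))) (at t within I)"
proof -
  have "((\<lambda>t. p t i \<bullet> (mass_rho G e *\<^sub>v p t i)) has_real_derivative
      2 * (p t i \<bullet> (mass_rho G e *\<^sub>v p' i))) (at t within I)" for i
    using bilinear_form_has_derivative[OF mass_rho(1)[OF e] p p p' dp dp t, of i i]
      bilinear_form_symmetric[OF mass_rho(1,2)[OF e] p' p[OF t], of i i]
    by (simp only: mult_2)
  hence "((\<lambda>t. \<Sum>i\<in>UNIV. p t i \<bullet> (mass_rho G e *\<^sub>v p t i)) has_real_derivative
      (\<Sum>i\<in>UNIV. 2 * (p t i \<bullet> (mass_rho G e *\<^sub>v p' i)))) (at t within I)"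
    by (intro DERIV_sum)
  thus ?thesis
    unfolding energy_def
    using DERIV_add[OF _ S_form_has_derivative[of e I s s' t, OF e s s' ds t]]
    by (simp add: sum_distrib_left distrib_left)
qed

section \<open>Constant states persist\<close>

text \<open>
  Applied to the deviations from the constant state, whose derivatives are those of the solution, the
  formula for the derivative of the energy turns both equations of the scheme into \<open>E'\<close>: the stress
  deviation is an admissible test collection.
\<close>

lemma constant_state_persists:
  assumes sym: "\<And>i j. \<alpha> i j = \<alpha> j i" and I: "time_interval I"
    and lip: "flux_locally_lipschitz G"
    and sol: "dg_solution G I v \<sigma>"
    and t0: "t0 \<in> I" and const0: "constant_state G \<beta> \<alpha> (v t0) (\<sigma> t0)"
    and t1: "t1 \<in> I" "t0 \<le> t1"
  shows "constant_state G \<beta> \<alpha> (v t1) (\<sigma> t1)"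
proof -
  define v0 where "v0 = (\<lambda>e i. \<beta> i \<cdot>\<^sub>v one_elem G e)"
  define \<sigma>0 where "\<sigma>0 = (\<lambda>e i j. \<alpha> i j \<cdot>\<^sub>v one_elem G e)"
  define dv where "dv = (\<lambda>t e i. v t e i - v0 e i)"
  define ds where "ds = (\<lambda>t e i j. \<sigma> t e i j - \<sigma>0 e i j)"
  define E where "E = (\<lambda>t. \<Sum>e\<in>elements G. energy e (dv t e) (ds t e))"
  define E' where "E' = (\<lambda>t. \<Sum>e\<in>elements G. 2 * (
    (\<Sum>i\<in>UNIV. dv t e i \<bullet> velocity_rhs G (v t) (\<sigma> t) e i) +
    (\<Sum>i\<in>UNIV. \<Sum>j\<in>UNIV. ds t e i j \<bullet> stress_rhs G (v t) (\<sigma> t) e i j)))"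
  have const: "constant_state G \<beta> \<alpha> v0 \<sigma>0"
    by (simp add: constant_state_def v0_def \<sigma>0_def)
  note D = dg_solutionD[OF sol]
  have sub: "{t0..t1} \<subseteq> I"
    using I t0 t1 mem_is_interval_1_I[of I t0 t1] unfolding time_interval_def by fastforce
  have c0: "v0 e i \<in> carrier_vec (ndof G e)" "\<sigma>0 e i j \<in> carrier_vec (ndof G e)" if "e \<in> elements G" for e i j
    using one_elem_carrier[OF that] by (auto simp: v0_def \<sigma>0_def)
  have cd: "dv t e i \<in> carrier_vec (ndof G e)" "ds t e i j \<in> carrier_vec (ndof G e)"
    if "e \<in> elements G" "t \<in> I" for e t i j
    using D(3,4) c0 that by (auto simp: dv_def ds_def)
  have symd: "sym_coll (ndof G e) (ds t e)" if "e \<in> elements G" "t \<in> I" for e t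
    using D(5)[OF that] cd(2)[OF that] sym by (auto simp: sym_coll_def ds_def \<sigma>0_def)
  have dv_index: "dv t e i $ a = v t e i $ a - v0 e i $ a" and ds_index: "ds t e i j $ a = \<sigma> t e i j $ a - \<sigma>0 e i j $ a"
    if "e \<in> elements G" "a < ndof G e" for t e i j a
    using carrier_vecD[OF c0(1)[OF that(1), of i]] carrier_vecD[OF c0(2)[OF that(1), of i j]] that(2)
    by (simp_all add: dv_def ds_def)

  have e_nonneg: "energy e (dv t e) (ds t e) \<ge> 0" if "e \<in> elements G" "t \<in> I" for e t
    using energy_coercive[OF that(1)] cd(1)[OF that] symd[OF that] by metis
  hence E_nonneg: "E t \<ge> 0" if "t \<in> I" for t
    unfolding E_def using that by (intro sum_nonneg)
  have e_le: "energy e (dv t e) (ds t e) \<le> E t" if "e \<in> elements G" "t \<in> I" for e t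
    unfolding E_def using e_nonneg that by (intro member_le_sum) auto
  have bound: "\<exists>c>0. \<forall>t\<in>I. \<forall>i j. \<forall>a<ndof G e. c * (dv t e i $ a)\<^sup>2 \<le> E t \<and> c * (ds t e i j $ a)\<^sup>2 \<le> E t"
    if e: "e \<in> elements G" for e
    by (rule energy_coercive[OF e])
       (use cd(1)[OF e] symd[OF e] e_le[OF e] in \<open>meson order_trans\<close>)

  have der: "(E has_real_derivative E' t) (at t within I)" if t: "t \<in> I" for t
    unfolding E_def
  proof (subst E'_def, rule DERIV_sum)
    fix e assume e: "e \<in> elements G"
    let ?N = "ndof G e"
    have dp: "((\<lambda>t. dv t e i $ a) has_real_derivative ddt I ?N (\<lambda>s. v s e i) t $ a) (at t within I)"
      if "a < ?N" for i a
      using DERIV_diff[OF differentiable_vec_has_derivative[OF D(1)[OF e] t that] DERIV_const]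
      by (simp add: dv_index[OF e that])
    have dq: "((\<lambda>t. ds t e i j $ a) has_real_derivative ddt I ?N (\<lambda>s. \<sigma> s e i j) t $ a) (at t within I)"
      if "a < ?N" for i j a
      using DERIV_diff[OF differentiable_vec_has_derivative[OF D(2)[OF e] t that] DERIV_const]
      by (simp add: ds_index[OF e that])
    show "((\<lambda>t. energy e (dv t e) (ds t e)) has_real_derivative 2 * (
        (\<Sum>i\<in>UNIV. dv t e i \<bullet> velocity_rhs G (v t) (\<sigma> t) e i) +
        (\<Sum>i\<in>UNIV. \<Sum>j\<in>UNIV. ds t e i j \<bullet> stress_rhs G (v t) (\<sigma> t) e i j))) (at t within I)"
      using energy_has_derivative[of e I "\<lambda>t. dv t e" "\<lambda>i. ddt I ?N (\<lambda>s. v s e i) t" "\<lambda>t. ds t e"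
          "\<lambda>i j. ddt I ?N (\<lambda>s. \<sigma> s e i j) t" t, OF e cd(1)[OF e] ddt_carrier cd(2)[OF e] ddt_carrier dp dq t]
      by (simp add: D(6)[OF e t] D(7)[OF e t symd[OF e t]])
  qed

  have "E t1 = 0"
  proof (rule zero_if_locally_gronwall[OF t1(2)])
    have "dv t0 e i = 0\<^sub>v (ndof G e)" "ds t0 e i j = 0\<^sub>v (ndof G e)" if "e \<in> elements G" for e i j
      using const0 c0[OF that] that by (auto simp: dv_def ds_def constant_state_def v0_def \<sigma>0_def)
    thus "E t0 = 0"
      unfolding E_def energy_def S_form_def
      using bilinear_form_zero[OF mass_rho(1)] bilinear_form_zero[OF mass_S(1)]
      by (auto intro!: sum.neutral)
    show "E t \<ge> 0" if "t \<in> {t0..t1}" for t using E_nonneg sub that by auto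
    show "(E has_real_derivative E' t) (at t within {t0..t1})" if "t \<in> {t0..t1}" for t
      using der[of t] sub that by (intro DERIV_subset[OF der sub]) auto
  next
    fix s assume s: "t0 \<le> s" "s < t1" "E s = 0"
    define g where "g = (\<lambda>t. sqrt (E t))"
    have ev_I: "\<forall>\<^sub>F t in at_right s. t \<in> I"
      using s sub unfolding eventually_at_right_field by (intro exI[of _ t1]) auto
    have "s \<in> I" "{s..t1} \<subseteq> I" using s sub by auto
    hence "(E \<longlongrightarrow> E s) (at s within {s..t1})"
      using DERIV_continuous[OF der] by (auto simp: continuous_within intro: tendsto_within_subset)
    hence "(E \<longlongrightarrow> 0) (at_right s)"
      using s by (simp add: at_within_Icc_at_right)
    hence g: "(g \<longlongrightarrow> 0) (at_right s)"
      unfolding g_def using tendsto_real_sqrt by fastforce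
    have sqrt_bound: "\<bar>x\<bar> \<le> 1 / sqrt c * norm (g t)" if "c > 0" "c * x\<^sup>2 \<le> E t" "t \<in> I" for c x t
    proof -
      have "\<bar>x\<bar> = sqrt (x\<^sup>2)" by simp
      also have "\<dots> \<le> sqrt (E t / c)" using that by (intro real_sqrt_le_mono) (simp add: field_simps)
      finally show ?thesis using that E_nonneg[of t] by (simp add: g_def real_sqrt_divide)
    qed
    have near_v: "near (at_right s) g (ndof G e) (\<lambda>t. v t e i) (v0 e i)"
      and near_\<sigma>: "near (at_right s) g (ndof G e) (\<lambda>t. \<sigma> t e i j) (\<sigma>0 e i j)"
      if e: "e \<in> elements G" for e i j
    proof -
      obtain c where c: "c > 0" "\<And>t i j a. t \<in> I \<Longrightarrow> a < ndof G e \<Longrightarrow>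
          c * (dv t e i $ a)\<^sup>2 \<le> E t \<and> c * (ds t e i j $ a)\<^sup>2 \<le> E t"
        using bound[OF e] by blast
      have "(\<lambda>t. v t e i $ a - v0 e i $ a) \<in> O[at_right s](g)"
        and "(\<lambda>t. \<sigma> t e i j $ a - \<sigma>0 e i j $ a) \<in> O[at_right s](g)" if a: "a < ndof G e" for a
      proof -
        have "\<forall>\<^sub>F t in at_right s. norm (dv t e i $ a) \<le> 1 / sqrt c * norm (g t)"
          "\<forall>\<^sub>F t in at_right s. norm (ds t e i j $ a) \<le> 1 / sqrt c * norm (g t)"
          unfolding real_norm_def[of "_ $ a"] using c(2)[OF _ a]
          by (auto intro!: eventually_mono[OF ev_I] sqrt_bound[OF c(1), simplified])
        thus "(\<lambda>t. v t e i $ a - v0 e i $ a) \<in> O[at_right s](g)"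
          "(\<lambda>t. \<sigma> t e i j $ a - \<sigma>0 e i j $ a) \<in> O[at_right s](g)"
          unfolding dv_index[OF e a] ds_index[OF e a] by (blast intro: bigoI)+
      qed
      thus "near (at_right s) g (ndof G e) (\<lambda>t. v t e i) (v0 e i)"
        "near (at_right s) g (ndof G e) (\<lambda>t. \<sigma> t e i j) (\<sigma>0 e i j)"
        unfolding near_def using c0[OF e] D(3,4)[OF e] by (auto intro: eventually_mono[OF ev_I])
    qed
    have near_dv: "near (at_right s) g (ndof G e) (\<lambda>t. dv t e i) (0\<^sub>v (ndof G e))"
      and near_ds: "near (at_right s) g (ndof G e) (\<lambda>t. ds t e i j) (0\<^sub>v (ndof G e))"
      if e: "e \<in> elements G" for e i j
      using near_diff[OF near_v near_const] near_diff[OF near_\<sigma> near_const] c0[OF e] e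
      unfolding dv_def ds_def by (metis minus_cancel_vec)+
    have near_vr: "near (at_right s) g (ndof G e) (\<lambda>t. velocity_rhs G (v t) (\<sigma> t) e i) (0\<^sub>v (ndof G e))"
      and near_sr: "near (at_right s) g (ndof G e) (\<lambda>t. stress_rhs G (v t) (\<sigma> t) e i j) (0\<^sub>v (ndof G e))"
      if e: "e \<in> elements G" for e i j
    proof -
      have "near (at_right s) g (ndof G e) (\<lambda>t. velocity_rhs G (v t) (\<sigma> t) e i) (velocity_rhs G v0 \<sigma>0 e i)"
        by (rule near_rhs(1)) (auto intro: lip g near_v near_\<sigma> e)
      moreover have "near (at_right s) g (ndof G e) (\<lambda>t. stress_rhs G (v t) (\<sigma> t) e i j) (stress_rhs G v0 \<sigma>0 e i j)"
        by (rule near_rhs(2)) (auto intro: lip g near_v near_\<sigma> e)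
      ultimately show "near (at_right s) g (ndof G e) (\<lambda>t. velocity_rhs G (v t) (\<sigma> t) e i) (0\<^sub>v (ndof G e))"
        "near (at_right s) g (ndof G e) (\<lambda>t. stress_rhs G (v t) (\<sigma> t) e i j) (0\<^sub>v (ndof G e))"
        by (simp_all add: velocity_rhs_constant[OF sym const e] stress_rhs_constant[OF sym const e])
    qed
    have "(\<lambda>t. dv t e i \<bullet> velocity_rhs G (v t) (\<sigma> t) e i) \<in> O[at_right s](\<lambda>t. g t * g t)"
      "(\<lambda>t. ds t e i j \<bullet> stress_rhs G (v t) (\<sigma> t) e i j) \<in> O[at_right s](\<lambda>t. g t * g t)"
      if "e \<in> elements G" for e i j
      using that by (auto intro: near_scalar_prod_zero near_dv near_vr near_ds near_sr)
    hence "E' \<in> O[at_right s](\<lambda>t. g t * g t)"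
      unfolding E'_def
      by (intro big_sum_in_bigo landau_o.big.cmult_in_iff[THEN iffD2] sum_in_bigo(1)) auto
    also have "O[at_right s](\<lambda>t. g t * g t) = O[at_right s](E)"
      by (intro landau_o.big.cong eventually_mono[OF ev_I]) (auto simp: g_def E_nonneg)
    finally show "E' \<in> O[at_right s](E)" .
  qed
  have "v t1 e i $ a = v0 e i $ a" "\<sigma> t1 e i j $ a = \<sigma>0 e i j $ a"
    if e: "e \<in> elements G" and a: "a < ndof G e" for e i j a
  proof -
    obtain c where "c > 0" "c * (dv t1 e i $ a)\<^sup>2 \<le> 0" "c * (ds t1 e i j $ a)\<^sup>2 \<le> 0"
      using bound[OF e] t1(1) a \<open>E t1 = 0\<close> by metis
    hence "dv t1 e i $ a = 0" "ds t1 e i j $ a = 0" by (simp_all add: mult_le_0_iff)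
    thus "v t1 e i $ a = v0 e i $ a" "\<sigma> t1 e i j $ a = \<sigma>0 e i j $ a"
      by (simp_all add: dv_index[OF e a] ds_index[OF e a])
  qed
  hence "v t1 e i = v0 e i" "\<sigma> t1 e i j = \<sigma>0 e i j" if "e \<in> elements G" for e i j
    using that carrier_vecD[OF c0(1)[OF that, of i]] carrier_vecD[OF c0(2)[OF that, of i j]]
      carrier_vecD[OF D(3)[OF that t1(1), of i]] carrier_vecD[OF D(4)[OF that t1(1), of i j]]
    by (auto intro!: eq_vecI)
  thus ?thesis
    by (simp add: constant_state_def v0_def \<sigma>0_def)
qed

end

theorem mainTheorem5:
  fixes G :: "('e, 'm, 'x::euclidean_space, 'y::euclidean_space) dg_scheme"
    and I :: "real set"
    and \<beta> :: "3 \<Rightarrow> real"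
    and \<alpha> :: "3 \<Rightarrow> 3 \<Rightarrow> real"
  assumes "dg_ok G"
    and "no_boundary_mortars G"
    and "approximation_consistent G"
    and "projection_consistent G"
    and "stiffness_consistent G"
    and "flux_consistent G"
    and "discrete_divergence G"
    and "constant_traction_consistent G"
    and "time_interval I"
    and "\<And>i j. \<alpha> i j = \<alpha> j i"
  shows
    "(\<forall>v \<sigma>. dg_solution G I v \<sigma> \<longrightarrow>
        (\<forall>t\<in>I. constant_state G \<beta> \<alpha> (v t) (\<sigma> t) \<longrightarrow>
          (\<forall>e\<in>elements G. \<forall>i j.
             mass_rho G e *\<^sub>v ddt I (ndof G e) (\<lambda>s. v s e i) t = 0\<^sub>v (ndof G e) \<and>
             mass_S_apply G e (\<lambda>k l. ddt I (ndof G e) (\<lambda>s. \<sigma> s e k l) t) i j = 0\<^sub>v (ndof G e) \<and>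
             ddt I (ndof G e) (\<lambda>s. v s e i) t = 0\<^sub>v (ndof G e) \<and>
             ddt I (ndof G e) (\<lambda>s. \<sigma> s e i j) t = 0\<^sub>v (ndof G e))))
     \<and> dg_solution G I (\<lambda>t e i. \<beta> i \<cdot>\<^sub>v one_elem G e) (\<lambda>t e i j. \<alpha> i j \<cdot>\<^sub>v one_elem G e)
     \<and> (flux_locally_lipschitz G \<longrightarrow>
        (\<forall>v \<sigma>. dg_solution G I v \<sigma> \<longrightarrow>
          (\<forall>t0\<in>I. constant_state G \<beta> \<alpha> (v t0) (\<sigma> t0) \<longrightarrow>
            (\<forall>t\<in>I. t0 \<le> t \<longrightarrow> constant_state G \<beta> \<alpha> (v t) (\<sigma> t)))))"
proof -
  interpret consistent_dg G
    using assms(1,3-8) by unfold_locales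
  show ?thesis
    by (intro conjI impI allI ballI)
      (fact constant_derivatives_zero[OF assms(10)] constant_solution[OF assms(10,9)]
        constant_state_persists[OF assms(10,9)])+
qed

end
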